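(* Let an absorbing positive recursive two-player stochastic game with finite state set $\mathcal S$, $|\mathcal S|=n$, be given, and let $(x,y)\in X\times Y$ be absorbing stationary strategies. Let $0<\epsilon<1/2$ and $\delta>0$, and assume that 1) for both players $k=1,2$ and every $s\in\mathcal S$, $r^k_{x,y}(s)>j^k_z(s)-\epsilon$, where $z=x$ if $k=2$ and $z=y$ if $k=1$; and 2) for both players $k=1,2$, every state $s$ and every move $c$ of Player $k$ at $s$ used with positive probability in $(x,y)$, $|w^k_{x,y}(c)-r^k_{x,y}(s)|\le\delta$. If $\delta\le \epsilon^3/n$, then the strategies $(x,y)$ generate a $4\epsilon$-equilibrium of the stochastic game.
   Context: Game: a finite set $\mathcal S=\mathcal N\sqcup\mathcal A$ of non-absorbing and absorbing states; finite nonempty move sets $A_1^s,A_2^s$ (singletons for $s\in\mathcal A$); next-state probabilities $p(t|s;a,b)$, with $p(s|s;\cdot,\cdot)=1$ for $s\in\mathcal A$; payoffs $r^1:\mathcal A\to[-1/2,1/2]$, $r^2:\mathcal A\to[\omega,1]$, $0<\omega<1$. A play reaching $t\in\mathcal A$ pays $r^i(t)$ to Player $i$; a play never absorbed pays $0$. The game is absorbing: Player Two has a strategy guaranteeing that an absorbing state is reached with probability one whatever Player One does and whatever the initial state. At each stage both players know the whole history and current state and move simultaneously; strategies map finite histories ending at $s$ to $\Delta(A_i^s)$. $\mathcal V_i^s(\sigma_1,\sigma_2)$ is Player $i$'s expected payoff from initial state $s$. $(\sigma_1,\sigma_2)$ is an $\eta$-equilibrium if for every initial state $s$ no player can increase $\mathcal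 V^s_i$ by more than $\eta$ by changing his strategy unilaterally. $X=\prod_{s\in\mathcal N}\Delta(A_1^s)$ and $Y=\prod_{s\in\mathcal N}\Delta(A_2^s)$ are the stationary strategies; $(x,y)$ is absorbing if from every start an absorbing state is reached with probability one. $r^i_{x,y}(s)$ is the expected payoff of Player $i$ from $s$ under $(x,y)$. For a move $c$ of Player $k$ at $s$, $w^k_{x,y}(c)$ is the expected value of $r^k_{x,y}$ at the next state when Player $k$ plays $c$ at $s$ and the other player plays his stationary strategy at $s$. $c_i(s)$ is the value, for Player $i$, of the zero-sum undiscounted game starting at $s$ in which the other player tries to minimize Player $i$'s expected payoff. Jump functions: $j^2_x(s)=\max_{b\in A_2^s}\sum_t p(t|s;x,b)\,c_2(t)$ and $j^1_y(s)=\max_{a\in A_1^s}\sum_t p(t|s;a,y)\,c_1(t)$ (with $p(t|s;x,b)$, $p(t|s;a,y)$ the linear extensions). "$(x,y)$ generate a $4\epsilon$-equilibrium" means: there is a $4\epsilon$-equilibrium $(\sigma_1,\sigma_2)$ in which both players act according to $x$ and $y$ until a (possibly never occurring) stopping time determined by the history of play, and from that time on both players punish each other, i.e. each Player $k$ uses a strategy holding the other Player $i$ to an expected continuation payoff of at most $c_i(\cdot)+\eta$, for some $\eta\in(0,\epsilon]$. *)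

theory Defs
  imports "HOL-Probability.Probability"
begin

datatype player = One | Two

fun other :: "player \<Rightarrow> player" where
  "other One = Two"
| "other Two = One"

text \<open>
  The finite state set is the whole type \<open>'s\<close>; the non-absorbing states are the complement of
  \<open>absorbing\<close>. The moves of both players are drawn from one finite type, the available ones being
  the sets \<open>moves G k s\<close>. The values of \<open>trans\<close> at unavailable moves are irrelevant, and so are
  those of \<open>pay\<close> at non-absorbing states.
\<close>

record ('s, 'm) game =
  absorbing :: "'s set"
  moves :: "player \<Rightarrow> 's \<Rightarrow> 'm set"
  trans :: "'s \<Rightarrow> 'm \<Rightarrow> 'm \<Rightarrow> 's pmf"
  pay :: "player \<Rightarrow> 's \<Rightarrow> real"

text \<open>
  A finite history is a list of completed stages (state, move of Player One, move of Player Two),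
  in chronological order, followed by the current state. Strategies are total functions; what they
  do on lists that are not possible histories of the game has no effect on any play.
\<close>

type_synonym ('s, 'm) stage = "'s \<times> 'm \<times> 'm"
type_synonym ('s, 'm) strategy = "('s, 'm) stage list \<Rightarrow> 's \<Rightarrow> 'm pmf"
type_synonym ('s, 'm) stationary = "'s \<Rightarrow> 'm pmf"

definition is_strategy :: "('s, 'm) game \<Rightarrow> player \<Rightarrow> ('s, 'm) strategy \<Rightarrow> bool" where
  "is_strategy G k \<tau> \<longleftrightarrow> (\<forall>h s. set_pmf (\<tau> h s) \<subseteq> moves G k s)"

text \<open>
  A stationary strategy is also given at the absorbing states, where it is the only available move.
\<close>

definition is_stationary :: "('s, 'm) game \<Rightarrow> player \<Rightarrow> ('s, 'm) stationary \<Rightarrow> bool" where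
  "is_stationary G k u \<longleftrightarrow> (\<forall>s. set_pmf (u s) \<subseteq> moves G k s)"

definition stationary :: "('s, 'm) stationary \<Rightarrow> ('s, 'm) strategy" where
  "stationary u = (\<lambda>h. u)"

text \<open>The probability measure on infinite plays, by the theorem of Ionescu Tulcea\<close>

definition stage_pmf :: "(player \<Rightarrow> ('s, 'm) strategy) \<Rightarrow> ('s, 'm) stage list \<Rightarrow> 's
    \<Rightarrow> ('s, 'm) stage pmf" where
  "stage_pmf \<sigma> h s = do { a \<leftarrow> \<sigma> One h s; b \<leftarrow> \<sigma> Two h s; return_pmf (s, a, b) }"

definition play_kernel :: "('s, 'm) game \<Rightarrow> (player \<Rightarrow> ('s, 'm) strategy) \<Rightarrow> 's
    \<Rightarrow> nat \<Rightarrow> (nat \<Rightarrow> ('s, 'm) stage) \<Rightarrow> ('s, 'm) stage measure" where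
  "play_kernel G \<sigma> s n \<omega> = measure_pmf
     (case n of
        0 \<Rightarrow> stage_pmf \<sigma> [] s
      | Suc m \<Rightarrow> (case \<omega> m of (u, a, b) \<Rightarrow>
          do { t \<leftarrow> trans G u a b; stage_pmf \<sigma> (map \<omega> [0..<n]) t }))"

definition play :: "('s, 'm) game \<Rightarrow> (player \<Rightarrow> ('s, 'm) strategy) \<Rightarrow> 's
    \<Rightarrow> (nat \<Rightarrow> ('s, 'm) stage) measure" where
  "play G \<sigma> s = projective_family.lim UNIV
     (Ionescu_Tulcea.CI (play_kernel G \<sigma> s) (\<lambda>_. count_space UNIV)) (\<lambda>_. count_space UNIV)"

definition state_at :: "(nat \<Rightarrow> ('s, 'm) stage) \<Rightarrow> nat \<Rightarrow> 's" where
  "state_at \<omega> n = fst (\<omega> n)"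

definition absorbed :: "('s, 'm) game \<Rightarrow> (nat \<Rightarrow> ('s, 'm) stage) \<Rightarrow> bool" where
  "absorbed G \<omega> \<longleftrightarrow> (\<exists>n. state_at \<omega> n \<in> absorbing G)"

definition payoff :: "('s, 'm) game \<Rightarrow> player \<Rightarrow> (nat \<Rightarrow> ('s, 'm) stage) \<Rightarrow> real" where
  "payoff G i \<omega> = (if absorbed G \<omega>
     then pay G i (state_at \<omega> (LEAST n. state_at \<omega> n \<in> absorbing G)) else 0)"

definition expected_payoff :: "('s, 'm) game \<Rightarrow> (player \<Rightarrow> ('s, 'm) strategy) \<Rightarrow> player
    \<Rightarrow> 's \<Rightarrow> real" where
  "expected_payoff G \<sigma> i s = (\<integral>\<omega>. payoff G i \<omega> \<partial>play G \<sigma> s)"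

definition surely_absorbed :: "('s, 'm) game \<Rightarrow> (player \<Rightarrow> ('s, 'm) strategy) \<Rightarrow> bool" where
  "surely_absorbed G \<sigma> \<longleftrightarrow> (\<forall>s. AE \<omega> in play G \<sigma> s. absorbed G \<omega>)"

definition absorbing_positive_recursive_game :: "('s, 'm) game \<Rightarrow> real \<Rightarrow> bool" where
  "absorbing_positive_recursive_game G w \<longleftrightarrow>
     0 < w \<and> w < 1 \<and>
     (\<forall>k s. moves G k s \<noteq> {}) \<and>
     (\<forall>s\<in>absorbing G. \<forall>k. is_singleton (moves G k s)) \<and>
     (\<forall>s\<in>absorbing G. \<forall>a\<in>moves G One s. \<forall>b\<in>moves G Two s. trans G s a b = return_pmf s) \<and>
     (\<forall>s\<in>absorbing G. pay G One s \<in> {-1/2..1/2} \<and> pay G Two s \<in> {w..1}) \<and>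
     (\<exists>\<sigma>2. is_strategy G Two \<sigma>2 \<and>
        (\<forall>\<sigma>1. is_strategy G One \<sigma>1 \<longrightarrow> surely_absorbed G (case_player \<sigma>1 \<sigma>2)))"

text \<open>
  The number \<open>v\<close> is the value, for Player \<open>i\<close>, of the zero-sum undiscounted game from \<open>s\<close>
  in which the other player minimizes the expected payoff of Player \<open>i\<close>.
\<close>

definition is_value :: "('s, 'm) game \<Rightarrow> player \<Rightarrow> 's \<Rightarrow> real \<Rightarrow> bool" where
  "is_value G i s v \<longleftrightarrow> (\<forall>e>0.
     (\<exists>\<sigma>. is_strategy G i (\<sigma> i) \<and> (\<forall>\<tau>. is_strategy G (other i) \<tau> \<longrightarrow>
        expected_payoff G (\<sigma>(other i := \<tau>)) i s \<ge> v - e)) \<and>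
     (\<exists>\<sigma>. is_strategy G (other i) (\<sigma> (other i)) \<and> (\<forall>\<tau>. is_strategy G i \<tau> \<longrightarrow>
        expected_payoff G (\<sigma>(i := \<tau>)) i s \<le> v + e)))"

definition next_state :: "('s, 'm) game \<Rightarrow> 's \<Rightarrow> (player \<Rightarrow> 'm pmf) \<Rightarrow> 's pmf" where
  "next_state G s \<alpha> = do { a \<leftarrow> \<alpha> One; b \<leftarrow> \<alpha> Two; trans G s a b }"

text \<open>
  Expectation of \<open>f\<close> at the next state when Player \<open>k\<close> plays the pure move \<open>m\<close> at \<open>s\<close> and
  the other player uses the stationary strategy \<open>u\<close>
\<close>

definition expected_next :: "('s::finite, 'm) game \<Rightarrow> player \<Rightarrow> ('s, 'm) stationary
    \<Rightarrow> ('s \<Rightarrow> real) \<Rightarrow> 's \<Rightarrow> 'm \<Rightarrow> real" where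
  "expected_next G k u f s m =
     (\<Sum>t\<in>UNIV. pmf (next_state G s (\<lambda>i. if i = k then return_pmf m else u s)) t * f t)"

definition jump :: "('s::finite, 'm) game \<Rightarrow> (player \<Rightarrow> 's \<Rightarrow> real) \<Rightarrow> player
    \<Rightarrow> ('s, 'm) stationary \<Rightarrow> 's \<Rightarrow> real" where
  "jump G c k u s = Max (expected_next G k u (c k) s ` moves G k s)"

definition r_stat :: "('s, 'm) game \<Rightarrow> (player \<Rightarrow> ('s, 'm) stationary) \<Rightarrow> player
    \<Rightarrow> 's \<Rightarrow> real" where
  "r_stat G z k s = expected_payoff G (\<lambda>i. stationary (z i)) k s"

definition w_stat :: "('s::finite, 'm) game \<Rightarrow> (player \<Rightarrow> ('s, 'm) stationary) \<Rightarrow> player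
    \<Rightarrow> 's \<Rightarrow> 'm \<Rightarrow> real" where
  "w_stat G z k s m = expected_next G k (z (other k)) (r_stat G z k) s m"

definition is_equilibrium :: "('s, 'm) game \<Rightarrow> real \<Rightarrow> (player \<Rightarrow> ('s, 'm) strategy)
    \<Rightarrow> bool" where
  "is_equilibrium G \<eta> \<sigma> \<longleftrightarrow>
     (\<forall>k. is_strategy G k (\<sigma> k)) \<and>
     (\<forall>s k \<tau>. is_strategy G k \<tau> \<longrightarrow>
        expected_payoff G (\<sigma>(k := \<tau>)) k s \<le> expected_payoff G \<sigma> k s + \<eta>)"

text \<open>
  A stopping time is given by a predicate \<open>stop\<close> on histories: it is the first stage, if any,
  whose history satisfies \<open>stop\<close>.
\<close>

definition stopped_before :: "(('s, 'm) stage list \<Rightarrow> 's \<Rightarrow> bool) \<Rightarrow> ('s, 'm) stage list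
    \<Rightarrow> bool" where
  "stopped_before stop h \<longleftrightarrow> (\<exists>m<length h. stop (take m h) (fst (h ! m)))"

definition continuation :: "('s, 'm) stage list \<Rightarrow> ('s, 'm) strategy \<Rightarrow> ('s, 'm) strategy" where
  "continuation h \<tau> = (\<lambda>h'. \<tau> (h @ h'))"

definition generates_equilibrium :: "('s, 'm) game \<Rightarrow> (player \<Rightarrow> 's \<Rightarrow> real) \<Rightarrow> real
    \<Rightarrow> (player \<Rightarrow> ('s, 'm) stationary) \<Rightarrow> bool" where
  "generates_equilibrium G c \<epsilon> z \<longleftrightarrow> (\<exists>\<sigma> stop \<eta>.
     is_equilibrium G (4 * \<epsilon>) \<sigma> \<and>
     0 < \<eta> \<and> \<eta> \<le> \<epsilon> \<and>
     (\<forall>h s. \<not> stopped_before stop h \<and> \<not> stop h s \<longrightarrow> (\<forall>k. \<sigma> k h s = z k s)) \<and>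
     (\<forall>h s. \<not> stopped_before stop h \<and> stop h s \<longrightarrow>
        (\<forall>i \<tau>. is_strategy G i \<tau> \<longrightarrow>
           expected_payoff G ((\<lambda>k. continuation h (\<sigma> k))(i := \<tau>)) i s \<le> c i s + \<eta>)))"

text \<open>
  The measure \<open>play\<close> is well defined and payoffs are integrable, so that the integral in
  \<open>expected_payoff\<close> has its intended meaning; values are unique.
\<close>

lemma Ionescu_Tulcea_play:
  fixes G :: "('s::finite, 'm::finite) game"
  shows "Ionescu_Tulcea (play_kernel G \<sigma> s) (\<lambda>_. count_space UNIV)"
proof (rule Ionescu_Tulcea.intro)
  fix n :: nat
  have eq: "PiM {0..<n} (\<lambda>_. count_space (UNIV :: ('s, 'm) stage set))
      = count_space (PiE {0..<n} (\<lambda>_. UNIV))"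
    by (intro count_space_PiM_finite) simp_all
  show "play_kernel G \<sigma> s n \<in> PiM {0..<n} (\<lambda>_. count_space UNIV)
      \<rightarrow>\<^sub>M subprob_algebra (count_space UNIV)"
    unfolding eq by (auto simp: play_kernel_def measure_pmf_in_subprob_algebra)
next
  fix n and \<omega> :: "nat \<Rightarrow> ('s, 'm) stage"
  show "prob_space (play_kernel G \<sigma> s n \<omega>)"
    unfolding play_kernel_def by (rule prob_space_measure_pmf)
qed

lemma sets_play [measurable_cong]:
  fixes G :: "('s::finite, 'm::finite) game"
  shows "sets (play G \<sigma> s) = sets (PiM UNIV (\<lambda>_. count_space UNIV))"
proof -
  interpret Ionescu_Tulcea "play_kernel G \<sigma> s" "\<lambda>_. count_space UNIV"
    by (rule Ionescu_Tulcea_play)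
  show ?thesis unfolding play_def by simp
qed

lemma emeasure_play_cylinder:
  fixes G :: "('s::finite, 'm::finite) game"
  assumes "finite J" "X \<in> sets (PiM J (\<lambda>_. count_space UNIV))"
  shows "emeasure (play G \<sigma> s) (prod_emb UNIV (\<lambda>_. count_space UNIV) J X)
    = emeasure (Ionescu_Tulcea.CI (play_kernel G \<sigma> s) (\<lambda>_. count_space UNIV) J) X"
proof -
  interpret Ionescu_Tulcea "play_kernel G \<sigma> s" "\<lambda>_. count_space UNIV"
    by (rule Ionescu_Tulcea_play)
  show ?thesis unfolding play_def by (rule lim[OF assms])
qed

lemma prob_space_play:
  fixes G :: "('s::finite, 'm::finite) game"
  shows "prob_space (play G \<sigma> s)"
proof
  interpret Ionescu_Tulcea "play_kernel G \<sigma> s" "\<lambda>_. count_space UNIV"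
    by (rule Ionescu_Tulcea_play)
  interpret C: prob_space "CI {}" by (rule PF.prob_space_P) simp_all
  have "space (play G \<sigma> s) = prod_emb UNIV (\<lambda>_. count_space UNIV) {} {\<lambda>_. undefined}"
    using sets_eq_imp_space_eq[OF sets_play[of G \<sigma> s]] by (auto simp: space_PiM prod_emb_def)
  then have "emeasure (play G \<sigma> s) (space (play G \<sigma> s)) = emeasure (CI {}) {\<lambda>_. undefined}"
    by (simp add: emeasure_play_cylinder PiM_empty)
  also have "\<dots> = 1"
    using C.emeasure_space_1 by (simp add: CI_def space_PiM)
  finally show "emeasure (play G \<sigma> s) (space (play G \<sigma> s)) = 1" .
qed

lemma measurable_payoff:
  fixes G :: "('s::finite, 'm::finite) game"
  shows "payoff G i \<in> borel_measurable (play G \<sigma> s)"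
proof -
  have [measurable]: "(\<lambda>\<omega>. \<omega> n) \<in> PiM UNIV (\<lambda>_. count_space (UNIV :: ('s, 'm) stage set))
      \<rightarrow>\<^sub>M count_space UNIV" for n
    by (rule measurable_component_singleton) simp
  have [measurable]: "fst \<in> count_space (UNIV :: ('s, 'm) stage set) \<rightarrow>\<^sub>M count_space UNIV"
    by simp
  have [measurable]: "(\<lambda>\<omega>. state_at \<omega> n) \<in> play G \<sigma> s \<rightarrow>\<^sub>M count_space UNIV" for n
    unfolding state_at_def measurable_cong_sets[OF sets_play refl] by measurable
  have [measurable]: "(\<lambda>\<omega>. LEAST n. state_at \<omega> n \<in> absorbing G)
      \<in> play G \<sigma> s \<rightarrow>\<^sub>M count_space UNIV"
    by measurable
  have [measurable]: "(\<lambda>\<omega>. pay G i (state_at \<omega> n)) \<in> borel_measurable (play G \<sigma> s)" for n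
    by (rule measurable_compose[of "\<lambda>\<omega>. state_at \<omega> n" _ "count_space UNIV"]) auto
  have [measurable]: "(\<lambda>\<omega>. pay G i (state_at \<omega> (LEAST n. state_at \<omega> n \<in> absorbing G)))
      \<in> borel_measurable (play G \<sigma> s)"
    by (rule measurable_compose_countable) auto
  show ?thesis
    unfolding payoff_def[abs_def] absorbed_def by measurable
qed

lemma integrable_payoff:
  fixes G :: "('s::finite, 'm::finite) game"
  shows "integrable (play G \<sigma> s) (payoff G i)"
proof -
  interpret prob_space "play G \<sigma> s" by (rule prob_space_play)
  have "norm (payoff G i \<omega>) \<le> (\<Sum>t\<in>UNIV. \<bar>pay G i t\<bar>)" for \<omega> :: "nat \<Rightarrow> ('s, 'm) stage"
    using member_le_sum[of _ UNIV "\<lambda>t. \<bar>pay G i t\<bar>"]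
    by (auto simp: payoff_def intro!: sum_nonneg)
  then show ?thesis
    by (intro integrable_const_bound measurable_payoff) auto
qed

lemma is_value_unique:
  assumes "is_value G i s v" "is_value G i s v'"
  shows "v = v'"
proof -
  have le: "p \<le> q" if p: "is_value G i s p" and q: "is_value G i s q" for p q
  proof (rule ccontr)
    assume "\<not> p \<le> q"
    define e where "e = (p - q) / 3"
    have "e > 0" using \<open>\<not> p \<le> q\<close> by (simp add: e_def)
    then obtain \<sigma> where \<sigma>: "is_strategy G i (\<sigma> i)"
        "\<And>\<tau>. is_strategy G (other i) \<tau> \<Longrightarrow> expected_payoff G (\<sigma>(other i := \<tau>)) i s \<ge> p - e"
      using p unfolding is_value_def by blast
    obtain \<rho> where \<rho>: "is_strategy G (other i) (\<rho> (other i))"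
        "\<And>\<tau>. is_strategy G i \<tau> \<Longrightarrow> expected_payoff G (\<rho>(i := \<tau>)) i s \<le> q + e"
      using q \<open>e > 0\<close> unfolding is_value_def by blast
    have "k = i \<or> k = other i" for k by (cases k; cases i) auto
    moreover have "i \<noteq> other i" by (cases i) auto
    ultimately have "\<sigma>(other i := \<rho> (other i)) = \<rho>(i := \<sigma> i)"
      by (auto simp: fun_eq_iff)
    then have "p - e \<le> q + e"
      using \<sigma>(2)[OF \<rho>(1)] \<rho>(2)[OF \<sigma>(1)] by simp
    then show False using \<open>\<not> p \<le> q\<close> by (simp add: e_def field_simps)
  qed
  show ?thesis using le[OF assms] le[OF assms(2,1)] by simp
qed

end

theory Submission
  imports Defs
begin

text \<open>
  Let \<open>r k s\<close> be the payoff that the stationary profile \<open>z\<close> promises Player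
  \<open>k\<close>. Both players follow \<open>z\<close> and watch each other. The gain of Player
  \<open>k\<close> at a stage is what his move adds to his prospects, \<open>w_stat G z k s m - r k
  s\<close>. As long as the opponent follows \<open>z\<close> and no absorbing state is reached,
  \<open>r k\<close> minus the total gain is a martingale along the play. A deviation of Player
  \<open>k\<close> can thus be profitable only through a large total gain, a move outside the support of
  \<open>z\<close>, or an endless delay of absorption. The players stop, and punish from then on, when a
  total gain exceeds \<open>2 * \<epsilon>\<close>, when such a move occurs, or when \<open>N\<close>
  stages have passed. Values are at most jumps (\<open>value_le_jump\<close>), so the first hypothesis
  says that a stop, or an illegal move followed by a stop, leaves Player \<open>k\<close> with less than
  \<open>r k s + \<epsilon>\<close>, up to the error \<open>\<eta>\<close> of the punishment. All in all
  a deviation yields at most \<open>r k s + 3 * \<epsilon> + \<delta> + \<eta>\<close>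
  (\<open>deviation_payoff_le\<close>).

  It remains to see that stops are rare if nobody deviates. Absorption may take arbitrarily long, so a
  bound for the gain per stage says nothing by itself; what helps is that the total gain is a martingale
  whose variance is bounded independently of the number of stages. The gain \<open>g\<close> of a stage
  satisfies \<open>g\<^sup>2 \<le> \<delta> * \<bar>g\<bar>\<close>, and the mean of
  \<open>\<bar>g\<bar>\<close> is at most that of the change of \<open>r k\<close> in absolute value.
  But \<open>r k\<close> is a martingale with at most \<open>n\<close> values in an interval of length
  \<open>1\<close>, so that its expected total variation is at most \<open>n\<close>: the sum over all
  states \<open>u\<close> of \<open>\<bar>r k s - r k u\<bar>\<close> is bounded by \<open>n\<close> and
  increases on average by at least the expected change (\<open>spread_increases\<close>). Hence the
  total gain has variance at most \<open>\<delta> * n \<le> \<epsilon>^3\<close>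
  (\<open>potential_supermartingale\<close>), and by Chebyshev's argument one of the two exceeds
  \<open>2 * \<epsilon>\<close> with probability at most \<open>2 * \<epsilon>^3 / (2 *
  \<epsilon>)\<^sup>2 = \<epsilon> / 2\<close>. As \<open>z\<close> is absorbing, \<open>N\<close> can
  be chosen so late that it matters with probability at most \<open>\<epsilon> / 8\<close>. A stop costs
  at most \<open>1\<close>, the length of the payoff range, whence \<open>profile_payoff_ge\<close>; the
  bounds add up to \<open>4 * \<epsilon>\<close>.

  Since the players stop after at most \<open>N\<close> stages, all martingale arguments are backward
  inductions from stage \<open>N\<close>. They rest on the one-step equation
  \<open>expected_payoff_step\<close>, which follows from the law of finite histories under the measure
  on plays.
\<close>

section \<open>The law of finite histories\<close>

lemma continuation_Nil [simp]: "continuation [] \<tau> = \<tau>"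
  by (simp add: continuation_def)

lemma continuation_append: "continuation (h @ h') \<tau> = continuation h' (continuation h \<tau>)"
  by (simp add: continuation_def fun_eq_iff)

definition step_pmf :: "('s, 'm) game \<Rightarrow> (player \<Rightarrow> 'm pmf) \<Rightarrow> 's
    \<Rightarrow> (('s, 'm) stage \<times> 's) pmf" where
  "step_pmf G \<alpha> s = do { a \<leftarrow> \<alpha> One; b \<leftarrow> \<alpha> Two; t \<leftarrow> trans G s a b; return_pmf ((s, a, b), t) }"

primrec hist_pmf :: "('s, 'm) game \<Rightarrow> nat \<Rightarrow> (player \<Rightarrow> ('s, 'm) strategy) \<Rightarrow> 's
    \<Rightarrow> ('s, 'm) stage list pmf" where
  "hist_pmf G 0 \<sigma> s = return_pmf []"
| "hist_pmf G (Suc n) \<sigma> s = step_pmf G (\<lambda>k. \<sigma> k [] s) s \<bind>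
     (\<lambda>(x, t). map_pmf ((#) x) (hist_pmf G n (\<lambda>k. continuation [x] (\<sigma> k)) t))"

definition next_stage :: "('s, 'm) game \<Rightarrow> (player \<Rightarrow> ('s, 'm) strategy) \<Rightarrow> 's
    \<Rightarrow> ('s, 'm) stage list \<Rightarrow> ('s, 'm) stage pmf" where
  "next_stage G \<sigma> s h = (if h = [] then stage_pmf \<sigma> [] s
     else (case last h of (u, a, b) \<Rightarrow> trans G u a b \<bind> stage_pmf \<sigma> h))"

lemma stage_pmf_continuation:
  "stage_pmf (\<lambda>k. continuation h (\<sigma> k)) h' = stage_pmf \<sigma> (h @ h')"
  by (simp add: stage_pmf_def continuation_def fun_eq_iff)

text \<open>
  The state that follows a stage belongs to the next stage of a history. The law of histories is defined
  by conditioning on the first stage, which suits backward induction; the measure on plays is built by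
  appending stages at the end. The next lemmas show that both give the same law.
\<close>

lemma step_pmf_eq_stage_pmf:
  "step_pmf G (\<lambda>k. \<sigma> k [] s) s = stage_pmf \<sigma> [] s \<bind>
     (\<lambda>x. trans G (fst x) (fst (snd x)) (snd (snd x)) \<bind> (\<lambda>t. return_pmf (x, t)))"
  by (simp add: step_pmf_def stage_pmf_def bind_assoc_pmf bind_return_pmf)

lemma hist_pmf_Suc_stage:
  "hist_pmf G (Suc n) \<sigma> s =
     stage_pmf \<sigma> [] s \<bind> (\<lambda>x. trans G (fst x) (fst (snd x)) (snd (snd x)) \<bind>
       (\<lambda>t. map_pmf ((#) x) (hist_pmf G n (\<lambda>k. continuation [x] (\<sigma> k)) t)))"
  by (simp add: step_pmf_eq_stage_pmf bind_assoc_pmf bind_return_pmf)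

lemma hist_pmf_length: "h \<in> set_pmf (hist_pmf G n \<sigma> s) \<Longrightarrow> length h = n"
  by (induction n arbitrary: \<sigma> s h) auto

lemma hist_pmf_Suc_last:
  "hist_pmf G (Suc n) \<sigma> s = hist_pmf G n \<sigma> s \<bind>
     (\<lambda>h. map_pmf (\<lambda>x. h @ [x]) (next_stage G \<sigma> s h))"
proof (induction n arbitrary: \<sigma> s)
  case 0
  show ?case
    by (simp add: hist_pmf_Suc_stage next_stage_def map_pmf_def bind_return_pmf bind_assoc_pmf
        bind_return_pmf' del: hist_pmf.simps(2))
next
  case (Suc n)
  have ns: "hist_pmf G n (\<lambda>k. continuation [x] (\<sigma> k)) t \<bind>
      (\<lambda>h. map_pmf (\<lambda>y. x # h @ [y]) (next_stage G (\<lambda>k. continuation [x] (\<sigma> k)) t h))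
    = hist_pmf G n (\<lambda>k. continuation [x] (\<sigma> k)) t \<bind>
      (\<lambda>h. map_pmf (\<lambda>y. x # h @ [y])
        (if h = [] then stage_pmf \<sigma> [x] t else next_stage G \<sigma> s (x # h)))" for x t
    by (intro bind_pmf_cong refl)
       (auto simp: next_stage_def stage_pmf_continuation split: prod.splits)
  show ?case
  proof (cases n)
    case 0
    then show ?thesis
      by (auto simp: hist_pmf_Suc_stage next_stage_def map_pmf_def bind_return_pmf bind_assoc_pmf
          stage_pmf_continuation split_beta intro!: bind_pmf_cong simp del: hist_pmf.simps(2))
  next
    case (Suc m)
    have ne: "h \<noteq> []" if "h \<in> set_pmf (hist_pmf G n \<rho> t)" for h \<rho> t
      using hist_pmf_length[OF that] Suc by auto
    have "hist_pmf G (Suc (Suc n)) \<sigma> s = stage_pmf \<sigma> [] s \<bind> (\<lambda>x. trans G (fst x) (fst (snd x)) (snd (snd x)) \<bind>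
       (\<lambda>t. map_pmf ((#) x) (hist_pmf G (Suc n) (\<lambda>k. continuation [x] (\<sigma> k)) t)))"
      by (rule hist_pmf_Suc_stage)
    also have "\<dots> = stage_pmf \<sigma> [] s \<bind> (\<lambda>x. trans G (fst x) (fst (snd x)) (snd (snd x)) \<bind>
       (\<lambda>t. hist_pmf G n (\<lambda>k. continuation [x] (\<sigma> k)) t \<bind>
      (\<lambda>h. map_pmf (\<lambda>y. x # h @ [y]) (next_stage G \<sigma> s (x # h)))))"
      unfolding Suc.IH
      by (intro bind_pmf_cong refl) (simp add: map_bind_pmf pmf.map_comp comp_def ns,
         intro bind_pmf_cong refl, auto dest: ne)
    also have "\<dots> = hist_pmf G (Suc n) \<sigma> s \<bind> (\<lambda>h. map_pmf (\<lambda>x. h @ [x]) (next_stage G \<sigma> s h))"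
      by (simp add: hist_pmf_Suc_stage bind_assoc_pmf bind_map_pmf del: hist_pmf.simps)
    finally show ?thesis .
  qed
qed

lemma measurable_prefix:
  "(\<lambda>\<omega>. map \<omega> [0..<n]) \<in> PiM {0..<n} (\<lambda>_. count_space (UNIV :: 'a::finite set)) \<rightarrow>\<^sub>M count_space UNIV"
  by (subst count_space_PiM_finite) simp_all

lemma measurable_prefix_play:
  fixes G :: "('s::finite, 'm::finite) game"
  shows "(\<lambda>\<omega>. map \<omega> [0..<n]) \<in> play G \<sigma> s \<rightarrow>\<^sub>M count_space UNIV"
proof -
  have "(\<lambda>x. restrict x {0..<n}) \<in> PiM UNIV (\<lambda>_. count_space (UNIV :: ('s, 'm) stage set))
      \<rightarrow>\<^sub>M PiM {0..<n} (\<lambda>_. count_space UNIV)"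
    by (rule measurable_restrict_subset) simp
  from measurable_compose[OF this measurable_prefix]
  have "(\<lambda>\<omega>. map (restrict \<omega> {0..<n}) [0..<n])
      \<in> PiM UNIV (\<lambda>_. count_space (UNIV :: ('s, 'm) stage set)) \<rightarrow>\<^sub>M count_space UNIV" .
  also have "(\<lambda>\<omega> :: nat \<Rightarrow> ('s, 'm) stage. map (restrict \<omega> {0..<n}) [0..<n]) = (\<lambda>\<omega>. map \<omega> [0..<n])"
    by (auto simp: fun_eq_iff)
  finally show ?thesis by (simp add: measurable_cong_sets[OF sets_play refl])
qed

text \<open>
  The finite-stage measures of the Ionescu Tulcea construction append one stage at a time, exactly as in
  the recursion of \<open>hist_pmf_Suc_last\<close>, and the infinite measure projects onto them.
\<close>

lemma distr_play_prefix:
  fixes G :: "('s::finite, 'm::finite) game"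
  shows "distr (play G \<sigma> s) (count_space UNIV) (\<lambda>\<omega>. map \<omega> [0..<n]) = measure_pmf (hist_pmf G n \<sigma> s)"
proof -
  let ?M = "\<lambda>_::nat. count_space (UNIV :: ('s, 'm) stage set)"
  interpret Ionescu_Tulcea "play_kernel G \<sigma> s" ?M
    by (rule Ionescu_Tulcea_play)
  have eq: "PiM {0..<n} ?M = count_space (PiE {0..<n} (\<lambda>_. UNIV))" for n
    by (intro count_space_PiM_finite) simp_all
  have [measurable]: "(\<lambda>\<omega>. map \<omega> [0..<n]) \<in> PiM {0..<n} ?M \<rightarrow>\<^sub>M count_space UNIV" for n
    unfolding eq by simp
  have C: "distr (C 0 n (\<lambda>_. undefined)) (count_space UNIV) (\<lambda>\<omega>. map \<omega> [0..<n])
      = measure_pmf (hist_pmf G n \<sigma> s)" for n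
  proof (induction n)
    case 0
    then show ?case
      by (simp add: distr_return space_PiM return_pmf.rep_eq)
  next
    case (Suc n)
    have sC: "sets (C 0 n (\<lambda>_. undefined)) = sets (PiM {0..<n} ?M)"
      using sets_C[of "\<lambda>_. undefined" 0 n] by (simp add: space_PiM)
    have spC: "space (C 0 n (\<lambda>_. undefined)) = PiE {0..<n} (\<lambda>_. UNIV)"
      using sets_eq_imp_space_eq[OF sC] by (simp add: space_PiM)
    have m1: "(\<lambda>\<omega>. map \<omega> [0..<n]) \<in> C 0 n (\<lambda>_. undefined) \<rightarrow>\<^sub>M count_space UNIV"
      by (simp add: measurable_cong_sets[OF sC refl])
    have eP: "distr (eP n \<omega>) (count_space UNIV) (\<lambda>\<omega>. map \<omega> [0..<Suc n])
        = measure_pmf (map_pmf (\<lambda>x. map \<omega> [0..<n] @ [x]) (next_stage G \<sigma> s (map \<omega> [0..<n])))"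
      if "\<omega> \<in> PiE {0..<n} (\<lambda>_. UNIV)" for \<omega>
    proof -
      have k: "play_kernel G \<sigma> s n \<omega> = measure_pmf (next_stage G \<sigma> s (map \<omega> [0..<n]))"
        by (cases n) (auto simp: play_kernel_def next_stage_def split_beta)
      have [simp]: "fun_upd \<omega> n \<in> UNIV \<rightarrow> PiE {0..<Suc n} (\<lambda>_. UNIV)"
        using that by (auto simp: PiE_iff extensional_def)
      have "distr (eP n \<omega>) (count_space UNIV) (\<lambda>\<omega>. map \<omega> [0..<Suc n])
         = distr (measure_pmf (next_stage G \<sigma> s (map \<omega> [0..<n]))) (count_space UNIV)
             ((\<lambda>\<omega>. map \<omega> [0..<Suc n]) \<circ> fun_upd \<omega> n)"
        unfolding eP_def k by (intro distr_distr) (auto simp: eq)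
      also have "(\<lambda>\<omega>. map \<omega> [0..<Suc n]) \<circ> fun_upd \<omega> n = (\<lambda>x. map \<omega> [0..<n] @ [x])"
        by (auto simp: fun_eq_iff)
      finally show ?thesis by (simp add: map_pmf_rep_eq)
    qed
    have "distr (C 0 (Suc n) (\<lambda>_. undefined)) (count_space UNIV) (\<lambda>\<omega>. map \<omega> [0..<Suc n])
       = distr (C 0 n (\<lambda>_. undefined) \<bind> eP n) (count_space UNIV) (\<lambda>\<omega>. map \<omega> [0..<Suc n])"
      by simp
    also have "\<dots> = C 0 n (\<lambda>_. undefined) \<bind>
        (\<lambda>\<omega>. distr (eP n \<omega>) (count_space UNIV) (\<lambda>\<omega>. map \<omega> [0..<Suc n]))"
      by (rule distr_bind[where K="PiM {0..<Suc n} ?M"])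
         (auto simp: measurable_cong_sets[OF sC refl] spC PiE_eq_empty_iff simp del: upt_Suc)
    also have "\<dots> = C 0 n (\<lambda>_. undefined) \<bind>
        (\<lambda>\<omega>. measure_pmf (map_pmf (\<lambda>x. map \<omega> [0..<n] @ [x]) (next_stage G \<sigma> s (map \<omega> [0..<n]))))"
      by (rule bind_cong[OF refl]) (simp only: eP spC)
    also have "\<dots> = distr (C 0 n (\<lambda>_. undefined)) (count_space UNIV) (\<lambda>\<omega>. map \<omega> [0..<n]) \<bind>
        (\<lambda>h. measure_pmf (map_pmf (\<lambda>x. h @ [x]) (next_stage G \<sigma> s h)))"
      by (subst bind_distr[OF m1, where K="count_space UNIV"])
         (auto simp: spC PiE_eq_empty_iff measure_pmf_in_subprob_algebra)
    also have "\<dots> = measure_pmf (hist_pmf G (Suc n) \<sigma> s)"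
      unfolding Suc hist_pmf_Suc_last by (simp add: measure_pmf_bind)
    finally show ?case .
  qed
  have [measurable]: "(\<lambda>x. restrict x {0..<n}) \<in> PiM UNIV ?M \<rightarrow>\<^sub>M PiM {0..<n} ?M"
    by (rule measurable_restrict_subset) simp
  have [measurable]: "(\<lambda>x. restrict x {0..<n}) \<in> play G \<sigma> s \<rightarrow>\<^sub>M PiM {0..<n} ?M"
    by (simp add: measurable_cong_sets[OF sets_play refl])
  have up: "up_to {0..<n} = n"
  proof (rule antisym)
    show "up_to {0..<n} \<le> n" by (simp add: up_to_iff)
    show "n \<le> up_to {0..<n}" using up_to[of "{0..<n}"] by (cases "n = 0") (simp, force)
  qed
  have "distr (play G \<sigma> s) (count_space UNIV) (\<lambda>\<omega>. map \<omega> [0..<n])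
     = distr (distr (play G \<sigma> s) (PiM {0..<n} ?M) (\<lambda>x. restrict x {0..<n})) (count_space UNIV) (\<lambda>\<omega>. map \<omega> [0..<n])"
    by (subst distr_distr) (auto simp: comp_def intro!: distr_cong)
  also have "distr (play G \<sigma> s) (PiM {0..<n} ?M) (\<lambda>x. restrict x {0..<n}) = CI {0..<n}"
    unfolding play_def by (rule distr_lim) simp
  also have "\<dots> = distr (C 0 n (\<lambda>_. undefined)) (PiM {0..<n} ?M) (\<lambda>f. restrict f {0..<n})"
    unfolding CI_def up ..
  also have "distr \<dots> (count_space UNIV) (\<lambda>\<omega>. map \<omega> [0..<n])
      = distr (C 0 n (\<lambda>_. undefined)) (count_space UNIV) (\<lambda>\<omega>. map \<omega> [0..<n])"
  proof -
    have sC: "sets (C 0 n (\<lambda>_. undefined)) = sets (PiM {0..<n} ?M)"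
      using sets_C[of "\<lambda>_. undefined" 0 n] by (simp add: space_PiM)
    show ?thesis
      by (subst distr_distr)
        (auto simp: comp_def measurable_cong_sets[OF sC refl] eq PiE_iff intro!: distr_cong)
  qed
  also have "\<dots> = measure_pmf (hist_pmf G n \<sigma> s)" by (rule C)
  finally show ?thesis .
qed

section \<open>The one-step equation for expected payoffs\<close>

primrec list_payoff :: "('s, 'm) game \<Rightarrow> player \<Rightarrow> ('s, 'm) stage list \<Rightarrow> real" where
  "list_payoff G i [] = 0"
| "list_payoff G i (x # h) = (if fst x \<in> absorbing G then pay G i (fst x) else list_payoff G i h)"

lemma list_payoff_append:
  "\<forall>x\<in>set h. fst x \<notin> absorbing G \<Longrightarrow> list_payoff G i (h @ h') = list_payoff G i h'"
  by (induction h) auto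

text \<open>
  Along every play the truncated payoff becomes constant: at the stage of absorption, or from the start
  if the play is never absorbed.
\<close>

lemma list_payoff_tendsto: "(\<lambda>n. list_payoff G i (map \<omega> [0..<n])) \<longlonglongrightarrow> payoff G i \<omega>"
proof (cases "absorbed G \<omega>")
  case True
  define m where "m = (LEAST n. state_at \<omega> n \<in> absorbing G)"
  have m: "state_at \<omega> m \<in> absorbing G" and less: "\<And>j. j < m \<Longrightarrow> state_at \<omega> j \<notin> absorbing G"
    using True unfolding m_def absorbed_def by (auto intro: LeastI_ex dest: not_less_Least)
  have "list_payoff G i (map \<omega> [0..<n]) = payoff G i \<omega>" if "m < n" for n
  proof -
    have "[0..<n] = [0..<m] @ m # [Suc m..<n]"
      using upt_add_eq_append[of 0 m "n - m"] that by (simp add: upt_conv_Cons)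
    then have "list_payoff G i (map \<omega> [0..<n])
        = list_payoff G i (map \<omega> [0..<m] @ \<omega> m # map \<omega> [Suc m..<n])" by simp
    also have "\<dots> = pay G i (state_at \<omega> m)"
      using m less by (subst list_payoff_append) (auto simp: state_at_def)
    finally show ?thesis using True by (simp add: payoff_def m_def)
  qed
  then show ?thesis
    by (intro tendsto_eventually eventually_sequentiallyI[of "Suc m"]) auto
next
  case False
  then have "list_payoff G i (map \<omega> [0..<n] @ []) = list_payoff G i []" for n
    by (intro list_payoff_append) (auto simp: absorbed_def state_at_def)
  with False show ?thesis by (simp add: payoff_def)
qed

lemma abs_list_payoff_le:
  fixes G :: "('s::finite, 'm) game"
  shows "\<bar>list_payoff G i h\<bar> \<le> (\<Sum>t\<in>UNIV. \<bar>pay G i t\<bar>)"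
  using member_le_sum[of _ UNIV "\<lambda>t. \<bar>pay G i t\<bar>"] by (induction h) (auto intro!: sum_nonneg)

definition finite_payoff :: "('s, 'm) game \<Rightarrow> nat \<Rightarrow> (player \<Rightarrow> ('s, 'm) strategy) \<Rightarrow> player
    \<Rightarrow> 's \<Rightarrow> real" where
  "finite_payoff G n \<sigma> i s = measure_pmf.expectation (hist_pmf G n \<sigma> s) (list_payoff G i)"

lemma finite_payoff_tendsto:
  fixes G :: "('s::finite, 'm::finite) game"
  shows "(\<lambda>n. finite_payoff G n \<sigma> i s) \<longlonglongrightarrow> expected_payoff G \<sigma> i s"
proof -
  interpret prob_space "play G \<sigma> s" by (rule prob_space_play)
  note pre = measurable_prefix_play[of _ G \<sigma> s]
  have "finite_payoff G n \<sigma> i s = (\<integral>\<omega>. list_payoff G i (map \<omega> [0..<n]) \<partial>play G \<sigma> s)" for n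
    unfolding finite_payoff_def distr_play_prefix[symmetric] by (rule integral_distr[OF pre]) simp
  moreover have "(\<lambda>n. \<integral>\<omega>. list_payoff G i (map \<omega> [0..<n]) \<partial>play G \<sigma> s)
      \<longlonglongrightarrow> (\<integral>\<omega>. payoff G i \<omega> \<partial>play G \<sigma> s)"
    by (rule integral_dominated_convergence[where w="\<lambda>_. \<Sum>t\<in>UNIV. \<bar>pay G i t\<bar>"])
       (auto intro!: measurable_payoff list_payoff_tendsto abs_list_payoff_le measurable_compose[OF pre])
  ultimately show ?thesis by (simp add: expected_payoff_def)
qed

lemma expectation_bind_pmf:
  fixes h :: "'b \<Rightarrow> real"
  assumes "finite (set_pmf p)" "\<And>x. x \<in> set_pmf p \<Longrightarrow> finite (set_pmf (f x))"
  shows "measure_pmf.expectation (p \<bind> f) h = measure_pmf.expectation p (\<lambda>x. measure_pmf.expectation (f x) h)"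
  using assms by (subst pmf_expectation_bind[of "set_pmf p"]) (auto simp: integral_measure_pmf[of "set_pmf p"])

lemma finite_set_hist_pmf:
  fixes G :: "('s::finite, 'm::finite) game"
  shows "finite (set_pmf (hist_pmf G n \<sigma> s))"
  by (induction n arbitrary: \<sigma> s) auto

lemma fst_step_pmf: "y \<in> set_pmf (step_pmf G \<alpha> s) \<Longrightarrow> fst (fst y) = s"
  by (auto simp: step_pmf_def)

lemma finite_payoff_Suc:
  fixes G :: "('s::finite, 'm::finite) game"
  shows "finite_payoff G (Suc n) \<sigma> i s = (if s \<in> absorbing G then pay G i s
     else measure_pmf.expectation (step_pmf G (\<lambda>k. \<sigma> k [] s) s)
       (\<lambda>(x, t). finite_payoff G n (\<lambda>k. continuation [x] (\<sigma> k)) i t))"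
proof -
  have "finite_payoff G (Suc n) \<sigma> i s = measure_pmf.expectation (step_pmf G (\<lambda>k. \<sigma> k [] s) s)
    (\<lambda>(x, t). measure_pmf.expectation (hist_pmf G n (\<lambda>k. continuation [x] (\<sigma> k)) t) (\<lambda>h. list_payoff G i (x # h)))"
    unfolding finite_payoff_def hist_pmf.simps
    by (subst expectation_bind_pmf) (auto simp: finite_set_hist_pmf case_prod_beta')
  also have "\<dots> = measure_pmf.expectation (step_pmf G (\<lambda>k. \<sigma> k [] s) s)
    (\<lambda>(x, t). if s \<in> absorbing G then pay G i s else finite_payoff G n (\<lambda>k. continuation [x] (\<sigma> k)) i t)"
    by (intro integral_cong_AE) (auto simp: AE_measure_pmf_iff finite_payoff_def dest: fst_step_pmf)
  finally show ?thesis by (simp add: case_prod_beta')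
qed

text \<open>
  The limit of \<open>finite_payoff_Suc\<close> and the basis of all backward inductions over histories
\<close>

lemma expected_payoff_step:
  fixes G :: "('s::finite, 'm::finite) game"
  shows "expected_payoff G \<sigma> i s = (if s \<in> absorbing G then pay G i s
     else measure_pmf.expectation (step_pmf G (\<lambda>k. \<sigma> k [] s) s)
       (\<lambda>(x, t). expected_payoff G (\<lambda>k. continuation [x] (\<sigma> k)) i t))"
proof -
  let ?p = "step_pmf G (\<lambda>k. \<sigma> k [] s) s"
  have "(\<lambda>n. measure_pmf.expectation ?p (\<lambda>(x, t). finite_payoff G n (\<lambda>k. continuation [x] (\<sigma> k)) i t))
     \<longlonglongrightarrow> measure_pmf.expectation ?p (\<lambda>(x, t). expected_payoff G (\<lambda>k. continuation [x] (\<sigma> k)) i t)"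
    by (simp add: integral_measure_pmf[of UNIV] split_beta)
       (intro tendsto_sum tendsto_mult tendsto_const finite_payoff_tendsto)
  then have "(\<lambda>n. finite_payoff G (Suc n) \<sigma> i s) \<longlonglongrightarrow> (if s \<in> absorbing G then pay G i s
     else measure_pmf.expectation ?p (\<lambda>(x, t). expected_payoff G (\<lambda>k. continuation [x] (\<sigma> k)) i t))"
    by (simp add: finite_payoff_Suc)
  moreover have "(\<lambda>n. finite_payoff G (Suc n) \<sigma> i s) \<longlonglongrightarrow> expected_payoff G \<sigma> i s"
    by (intro LIMSEQ_Suc finite_payoff_tendsto)
  ultimately show ?thesis by (rule LIMSEQ_unique[rotated])
qed

lemma expectation_mono_pmf:
  fixes f g :: "'a::finite \<Rightarrow> real"
  assumes "\<And>y. y \<in> set_pmf p \<Longrightarrow> f y \<le> g y"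
  shows "measure_pmf.expectation p f \<le> measure_pmf.expectation p g"
  using assms by (intro integral_mono_AE integrable_measure_pmf_finite) (auto simp: AE_measure_pmf_iff)

section \<open>Separating the moves of the two players\<close>

definition initial_state :: "('s, 'm) stage list \<Rightarrow> 's \<Rightarrow> 's" where
  "initial_state h s = (if h = [] then s else fst (hd h))"

lemma initial_state_simps [simp]:
  "initial_state [] s = s" "initial_state (x # h) s = fst x"
  by (simp_all add: initial_state_def)

text \<open>
  A play from \<open>s\<close> only meets histories that begin at \<open>s\<close>, so two profiles that
  agree there have the same payoffs. One step suffices for the proof: every history that extends a first
  stage at \<open>s\<close> begins at \<open>s\<close>.
\<close>

lemma expected_payoff_cong:
  fixes G :: "('s::finite, 'm::finite) game"
  assumes "\<And>k h t. initial_state h t = s \<Longrightarrow> \<sigma> k h t = \<rho> k h t"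
  shows "expected_payoff G \<sigma> i s = expected_payoff G \<rho> i s"
proof -
  have 1: "(\<lambda>k. \<sigma> k [] s) = (\<lambda>k. \<rho> k [] s)"
    using assms by simp
  have 2: "(\<lambda>k. continuation [x] (\<sigma> k)) = (\<lambda>k. continuation [x] (\<rho> k))" if "fst x = s" for x
    using assms that by (auto simp: continuation_def fun_eq_iff)
  have "measure_pmf.expectation (step_pmf G (\<lambda>k. \<sigma> k [] s) s)
       (\<lambda>(x, t). expected_payoff G (\<lambda>k. continuation [x] (\<sigma> k)) i t)
     = measure_pmf.expectation (step_pmf G (\<lambda>k. \<rho> k [] s) s)
       (\<lambda>(x, t). expected_payoff G (\<lambda>k. continuation [x] (\<rho> k)) i t)"
    unfolding 1 by (intro integral_cong_AE) (auto simp: AE_measure_pmf_iff 2 dest!: fst_step_pmf)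
  then show ?thesis
    by (simp only: expected_payoff_step[of G \<sigma>] expected_payoff_step[of G \<rho>])
qed

fun move :: "player \<Rightarrow> ('s, 'm) stage \<Rightarrow> 'm" where
  "move One (s, a, b) = a"
| "move Two (s, a, b) = b"

lemma move_step_pmf: "y \<in> set_pmf (step_pmf G \<alpha> s) \<Longrightarrow> move k (fst y) \<in> set_pmf (\<alpha> k)"
  by (cases k) (auto simp: step_pmf_def)

lemma other_neq [simp]: "other k \<noteq> k" "k \<noteq> other k"
  by (cases k; simp)+

lemma eq_or_other: "j = k \<or> j = other k"
  by (cases k; cases j) auto

text \<open>
  Since moves are simultaneous, the move of either player may be drawn first.
\<close>

lemma step_pmf_split:
  "step_pmf G \<alpha> s = \<alpha> k \<bind> (\<lambda>m. step_pmf G (\<alpha>(k := return_pmf m)) s)"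
proof (cases k)
  case One
  then show ?thesis by (simp add: step_pmf_def bind_return_pmf)
next
  case Two
  then show ?thesis
    by (simp add: step_pmf_def bind_return_pmf) (rule bind_commute_pmf)
qed

lemma expectation_step_split:
  fixes G :: "('s::finite, 'm::finite) game" and f :: "_ \<Rightarrow> real"
  shows "measure_pmf.expectation (step_pmf G \<alpha> s) f = measure_pmf.expectation (\<alpha> k)
     (\<lambda>m. measure_pmf.expectation (step_pmf G (\<alpha>(k := return_pmf m)) s) f)"
  by (subst step_pmf_split[of G \<alpha> s k]) (rule expectation_bind_pmf; simp)

lemma expectation_step_move:
  fixes G :: "('s::finite, 'm::finite) game" and f :: "_ \<Rightarrow> real"
  shows "measure_pmf.expectation (step_pmf G \<alpha> s) (\<lambda>y. f (move k (fst y))) = measure_pmf.expectation (\<alpha> k) f"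
proof -
  have "measure_pmf.expectation (step_pmf G (\<alpha>(k := return_pmf m)) s) (\<lambda>y. f (move k (fst y))) = f m" for m
  proof -
    have "measure_pmf.expectation (step_pmf G (\<alpha>(k := return_pmf m)) s) (\<lambda>y. f (move k (fst y)))
      = measure_pmf.expectation (step_pmf G (\<alpha>(k := return_pmf m)) s) (\<lambda>y. f m)"
      by (intro integral_cong_AE) (auto simp: AE_measure_pmf_iff dest!: move_step_pmf[where k=k])
    then show ?thesis by simp
  qed
  then show ?thesis by (simp add: expectation_step_split[of G \<alpha> s _ k])
qed

lemma map_snd_step_pmf: "map_pmf snd (step_pmf G \<alpha> s) = next_state G s \<alpha>"
  by (simp add: step_pmf_def next_state_def map_bind_pmf bind_return_pmf' )

lemma expected_next_eq:
  fixes G :: "('s::finite, 'm::finite) game"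
  assumes "\<alpha> (other k) = u s"
  shows "expected_next G k u f s m
    = measure_pmf.expectation (step_pmf G (\<alpha>(k := return_pmf m)) s) (\<lambda>y. f (snd y))"
proof -
  have "(if i = k then return_pmf m else u s) = (\<alpha>(k := return_pmf m)) i" for i
    using assms eq_or_other[of i k] by auto
  then have "(\<lambda>i. if i = k then return_pmf m else u s) = \<alpha>(k := return_pmf m)"
    by (rule ext)
  then have "expected_next G k u f s m
      = measure_pmf.expectation (map_pmf snd (step_pmf G (\<alpha>(k := return_pmf m)) s)) f"
    by (simp add: expected_next_def map_snd_step_pmf integral_measure_pmf[of UNIV])
  then show ?thesis by simp
qed

lemma expected_next_le_jump:
  fixes G :: "('s::finite, 'm::finite) game"
  shows "m \<in> moves G k s \<Longrightarrow> expected_next G k u (c k) s m \<le> jump G c k u s"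
  by (simp add: jump_def)

lemma is_strategy_continuation: "is_strategy G k \<tau> \<Longrightarrow> is_strategy G k (continuation h \<tau>)"
  by (auto simp: is_strategy_def continuation_def)

section \<open>Punishment, values and jumps\<close>

definition restart :: "('s \<Rightarrow> ('s, 'm) strategy) \<Rightarrow> ('s, 'm) strategy" where
  "restart \<pi> h s = \<pi> (initial_state h s) h s"

text \<open>
  The opponent's strategy is only compared with \<open>\<rho>\<close> on histories that begin at
  \<open>s\<close>: this makes the notion apply to the continuation of a strategy that turns into
  \<open>\<rho>\<close> at a history ending in \<open>s\<close> and does something else on lists that do
  not extend it.
\<close>
definition punishes :: "('s, 'm) game \<Rightarrow> player \<Rightarrow> real \<Rightarrow> ('s \<Rightarrow> real) \<Rightarrow> ('s, 'm) strategy \<Rightarrow> bool" where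
  "punishes G i e v \<rho> \<longleftrightarrow> is_strategy G (other i) \<rho> \<and> (\<forall>\<sigma> s.
     is_strategy G i (\<sigma> i) \<longrightarrow> (\<forall>h t. initial_state h t = s \<longrightarrow> \<sigma> (other i) h t = \<rho> h t) \<longrightarrow>
       expected_payoff G \<sigma> i s \<le> v s + e)"

text \<open>
  Values are defined state by state, each with its own optimal strategies. Selecting the strategy by the
  state in which the history began gives one that punishes from all states.
\<close>

lemma punishing_strategy_exists:
  fixes G :: "('s::finite, 'm::finite) game"
  assumes "\<And>s. is_value G i s (v s)" and "0 < e"
  shows "\<exists>\<rho>. punishes G i e v \<rho>"
proof -
  have "\<exists>\<sigma>. is_strategy G (other i) (\<sigma> (other i)) \<and> (\<forall>\<tau>. is_strategy G i \<tau> \<longrightarrow>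
        expected_payoff G (\<sigma>(i := \<tau>)) i s \<le> v s + e)" for s
    using assms unfolding is_value_def by blast
  then obtain \<pi> where \<pi>: "\<And>s. is_strategy G (other i) (\<pi> s (other i))"
    "\<And>s \<tau>. is_strategy G i \<tau> \<Longrightarrow> expected_payoff G ((\<pi> s)(i := \<tau>)) i s \<le> v s + e"
    by metis
  let ?\<rho> = "restart (\<lambda>s. \<pi> s (other i))"
  have "is_strategy G (other i) ?\<rho>"
    using \<pi>(1) by (auto simp: is_strategy_def restart_def)
  moreover have "expected_payoff G \<sigma> i s \<le> v s + e"
    if "is_strategy G i (\<sigma> i)" and eq: "\<forall>h t. initial_state h t = s \<longrightarrow> \<sigma> (other i) h t = ?\<rho> h t" for \<sigma> s
  proof -
    have "expected_payoff G \<sigma> i s = expected_payoff G ((\<pi> s)(i := \<sigma> i)) i s"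
      using eq eq_or_other[of _ i] by (intro expected_payoff_cong) (auto simp: restart_def)
    then show ?thesis using \<pi>(2)[OF that(1)] by simp
  qed
  ultimately show ?thesis unfolding punishes_def by blast
qed

text \<open>
  Against Player \<open>i\<close> the opponent may play \<open>u\<close> for one stage and punish from
  the next state on. This holds Player \<open>i\<close> to the expected value of \<open>c i\<close>
  after his best first move, up to the punishing error, so his value is no larger.
\<close>

lemma value_le_jump:
  fixes G :: "('s::finite, 'm::finite) game"
  assumes val: "\<And>s. is_value G i s (c i s)"
    and u: "is_stationary G (other i) u"
    and abs: "\<And>s a b. s \<in> absorbing G \<Longrightarrow> a \<in> moves G One s \<Longrightarrow> b \<in> moves G Two s \<Longrightarrow> trans G s a b = return_pmf s"
    and ne: "moves G i s \<noteq> {}"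
  shows "c i s \<le> jump G c i u s"
proof (cases "s \<in> absorbing G")
  case True
  from ne obtain m where m: "m \<in> moves G i s" by auto
  have "measure_pmf.expectation (step_pmf G ((\<lambda>_. u s)(i := return_pmf m)) s) (\<lambda>y. c i (snd y))
    = measure_pmf.expectation (step_pmf G ((\<lambda>_. u s)(i := return_pmf m)) s) (\<lambda>y. c i s)"
  proof (intro integral_cong_AE)
    have "snd y = s" if "y \<in> set_pmf (step_pmf G ((\<lambda>_. u s)(i := return_pmf m)) s)" for y
    proof -
      have "set_pmf (((\<lambda>_. u s)(i := return_pmf m)) k) \<subseteq> moves G k s" for k
        using m u eq_or_other[of k i] by (auto simp: is_stationary_def)
      from this[of One] this[of Two] that abs[OF True] show ?thesis
        by (fastforce simp: step_pmf_def)
    qed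
    then show "AE y in measure_pmf (step_pmf G ((\<lambda>_. u s)(i := return_pmf m)) s). c i (snd y) = c i s"
      by (auto simp: AE_measure_pmf_iff)
  qed auto
  then have "expected_next G i u (c i) s m = c i s"
    by (subst expected_next_eq[where \<alpha>="\<lambda>_. u s"]) auto
  then show ?thesis using expected_next_le_jump[OF m, of u c] by simp
next
  case False
  show ?thesis
  proof (rule field_le_epsilon)
    fix e :: real assume "0 < e"
    then have e: "0 < e / 2" by simp
    obtain \<sigma> where \<sigma>: "is_strategy G i (\<sigma> i)"
      "\<And>\<tau>. is_strategy G (other i) \<tau> \<Longrightarrow> expected_payoff G (\<sigma>(other i := \<tau>)) i s \<ge> c i s - e / 2"
      using val[of s] e unfolding is_value_def by blast
    obtain \<rho> where \<rho>: "punishes G i (e / 2) (c i) \<rho>"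
      using punishing_strategy_exists[of G i "c i", OF val e] by auto
    define \<tau> where "\<tau> = (\<lambda>h. case h of [] \<Rightarrow> u | x # h' \<Rightarrow> \<rho> h')"
    have \<tau>: "is_strategy G (other i) \<tau>"
      using \<rho> u by (auto simp: is_strategy_def is_stationary_def punishes_def \<tau>_def split: list.split)
    let ?\<sigma> = "\<sigma>(other i := \<tau>)" and ?\<alpha> = "\<lambda>k. (\<sigma>(other i := \<tau>)) k [] s"
    have next_eq: "expected_next G i u (c i) s
        = (\<lambda>m. measure_pmf.expectation (step_pmf G (?\<alpha>(i := return_pmf m)) s) (\<lambda>y. c i (snd y)))"
      by (rule ext, rule expected_next_eq) (simp add: \<tau>_def)
    have "expected_payoff G ?\<sigma> i s = measure_pmf.expectation (step_pmf G ?\<alpha> s)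
       (\<lambda>(x, t). expected_payoff G (\<lambda>k. continuation [x] (?\<sigma> k)) i t)"
      using False by (subst expected_payoff_step) (simp only: if_False)
    also have "\<dots> \<le> measure_pmf.expectation (step_pmf G ?\<alpha> s) (\<lambda>y. c i (snd y) + e / 2)"
    proof (rule expectation_mono_pmf, clarify, unfold snd_conv)
      fix s0 a b t
      show "expected_payoff G (\<lambda>k. continuation [(s0, a, b)] (?\<sigma> k)) i t \<le> c i t + e / 2"
      proof (rule \<rho>[unfolded punishes_def, THEN conjunct2, rule_format])
        show "is_strategy G i (continuation [(s0, a, b)] (?\<sigma> i))"
          using \<sigma>(1) by (simp add: is_strategy_continuation)
      qed (simp add: \<tau>_def continuation_def)
    qed
    also have "\<dots> = measure_pmf.expectation (step_pmf G ?\<alpha> s) (\<lambda>y. c i (snd y)) + e / 2"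
      by (subst Bochner_Integration.integral_add) (auto intro: integrable_measure_pmf_finite)
    also have "measure_pmf.expectation (step_pmf G ?\<alpha> s) (\<lambda>y. c i (snd y))
        = measure_pmf.expectation (?\<alpha> i) (expected_next G i u (c i) s)"
      unfolding expectation_step_split[of G ?\<alpha> s _ i] next_eq ..
    also have "\<dots> \<le> measure_pmf.expectation (?\<alpha> i) (\<lambda>_. jump G c i u s)"
      using \<sigma>(1) by (intro expectation_mono_pmf expected_next_le_jump) (auto simp: is_strategy_def)
    finally have "expected_payoff G ?\<sigma> i s \<le> jump G c i u s + e / 2"
      by (simp del: fun_upd_apply)
    then show "c i s \<le> jump G c i u s + e" using \<sigma>(2)[OF \<tau>] by linarith
  qed
qed

section \<open>Switching at a stopping time\<close>

text \<open>
  The index \<open>m = length h\<close>, at which the current state \<open>s\<close> is the last one, is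
  included: a stop at the current history takes effect at once.
\<close>
definition stop_at :: "(('s, 'm) stage list \<Rightarrow> 's \<Rightarrow> bool) \<Rightarrow> ('s, 'm) stage list \<Rightarrow> 's \<Rightarrow> nat \<Rightarrow> bool" where
  "stop_at stop h s m \<longleftrightarrow> m \<le> length h \<and> stop (take m h) (initial_state (drop m h) s)"

text \<open>
  From the first stop on, the strategy \<open>\<rho>\<close> is played as if the history began at the
  stop.
\<close>
definition switch :: "(('s, 'm) stage list \<Rightarrow> 's \<Rightarrow> bool) \<Rightarrow> ('s, 'm) stationary
    \<Rightarrow> ('s, 'm) strategy \<Rightarrow> ('s, 'm) strategy" where
  "switch stop u \<rho> h s = (if \<exists>m. stop_at stop h s m
     then \<rho> (drop (LEAST m. stop_at stop h s m) h) s else u s)"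

lemma stop_at_iff:
  "stop_at stop h s m \<longleftrightarrow> (m < length h \<and> stop (take m h) (fst (h ! m))) \<or> (m = length h \<and> stop h s)"
  by (cases "m < length h") (auto simp: stop_at_def initial_state_def hd_drop_conv_nth)

lemma switch_before:
  "\<not> stopped_before stop h \<Longrightarrow> \<not> stop h s \<Longrightarrow> switch stop u \<rho> h s = u s"
  by (auto simp: switch_def stop_at_iff stopped_before_def)

lemma switch_after:
  assumes "\<not> stopped_before stop h" "stop h s" "initial_state h' t = s"
  shows "switch stop u \<rho> (h @ h') t = \<rho> h' t"
proof -
  have 1: "stop_at stop (h @ h') t (length h)"
    using assms by (simp add: stop_at_def)
  have "(LEAST m. stop_at stop (h @ h') t m) = length h"
  proof (rule Least_equality)
    show "stop_at stop (h @ h') t (length h)" by (rule 1)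
    show "length h \<le> m" if "stop_at stop (h @ h') t m" for m
    proof (rule ccontr)
      assume "\<not> length h \<le> m"
      with that assms(1) show False by (auto simp: stop_at_iff stopped_before_def nth_append)
    qed
  qed
  with 1 show ?thesis by (auto simp: switch_def)
qed

lemma is_strategy_switch:
  "is_stationary G k u \<Longrightarrow> is_strategy G k \<rho> \<Longrightarrow> is_strategy G k (switch stop u \<rho>)"
  by (auto simp: is_strategy_def is_stationary_def switch_def)

lemma stopped_before_snoc:
  "stopped_before stop (h @ [x]) \<longleftrightarrow> stopped_before stop h \<or> stop h (fst x)"
  by (simp add: stopped_before_def Ex_less_Suc nth_append disj_commute cong: conj_cong)

section \<open>Payoff bounds and survival\<close>

text \<open>
  The payoffs of a player, including \<open>0\<close> for plays that are never absorbed, lie in an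
  interval of length \<open>1\<close> with this left end.
\<close>
definition least_payoff :: "player \<Rightarrow> real" where
  "least_payoff i = (case i of One \<Rightarrow> - 1 / 2 | Two \<Rightarrow> 0)"

lemma expected_payoff_bounds:
  fixes G :: "('s::finite, 'm::finite) game"
  assumes "absorbing_positive_recursive_game G w"
  shows "least_payoff i \<le> expected_payoff G \<sigma> i s" "expected_payoff G \<sigma> i s \<le> least_payoff i + 1"
proof -
  interpret prob_space "play G \<sigma> s" by (rule prob_space_play)
  have b: "least_payoff i \<le> payoff G i \<omega> \<and> payoff G i \<omega> \<le> least_payoff i + 1" for \<omega>
  proof (cases "absorbed G \<omega>")
    case True
    then have "state_at \<omega> (LEAST n. state_at \<omega> n \<in> absorbing G) \<in> absorbing G"
      unfolding absorbed_def by (rule LeastI_ex)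
    with assms True show ?thesis
      by (cases i) (fastforce simp: absorbing_positive_recursive_game_def payoff_def least_payoff_def)+
  next
    case False
    then show ?thesis by (cases i) (simp_all add: payoff_def least_payoff_def)
  qed
  show "least_payoff i \<le> expected_payoff G \<sigma> i s" "expected_payoff G \<sigma> i s \<le> least_payoff i + 1"
    unfolding expected_payoff_def using b
    by (auto intro!: integral_ge_const integral_le_const integrable_payoff)
qed

text \<open>
  The probability of no absorption in the first \<open>d\<close> stages, expressed through the payoff
  that is \<open>1\<close> at every absorbing state
\<close>
definition survival :: "('s, 'm) game \<Rightarrow> (player \<Rightarrow> ('s, 'm) stationary) \<Rightarrow> nat \<Rightarrow> 's \<Rightarrow> real" where
  "survival G z d s = 1 - finite_payoff (G\<lparr>pay := \<lambda>_ _. 1\<rparr>) d (\<lambda>k. stationary (z k)) One s"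

lemma survival_0 [simp]: "survival G z 0 s = 1"
  by (simp add: survival_def finite_payoff_def)

lemma survival_Suc:
  fixes G :: "('s::finite, 'm::finite) game"
  assumes "s \<notin> absorbing G"
  shows "survival G z (Suc d) s
    = measure_pmf.expectation (step_pmf G (\<lambda>k. z k s) s) (\<lambda>y. survival G z d (snd y))"
proof -
  have "step_pmf (G\<lparr>pay := \<lambda>_ _. 1\<rparr>) = step_pmf G"
    by (simp add: step_pmf_def fun_eq_iff)
  then show ?thesis
    using assms unfolding survival_def
    by (subst Bochner_Integration.integral_diff)
       (auto intro: integrable_measure_pmf_finite simp: finite_payoff_Suc case_prod_beta' stationary_def continuation_def)
qed

lemma survival_nonneg:
  fixes G :: "('s::finite, 'm::finite) game"
  shows "0 \<le> survival G z d s"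
proof -
  let ?G = "G\<lparr>pay := \<lambda>_ _. 1\<rparr>"
  have "list_payoff ?G i h \<le> 1" for i h
    by (induction h) auto
  then have "finite_payoff ?G d (\<lambda>k. stationary (z k)) One s
      \<le> measure_pmf.expectation (hist_pmf ?G d (\<lambda>k. stationary (z k)) s) (\<lambda>_. 1)"
    unfolding finite_payoff_def
    by (intro integral_mono integrable_measure_pmf_finite finite_set_hist_pmf)
  then show ?thesis by (simp add: survival_def)
qed

lemma survival_tendsto_0:
  fixes G :: "('s::finite, 'm::finite) game"
  assumes "surely_absorbed G (\<lambda>k. stationary (z k))"
  shows "(\<lambda>d. survival G z d s) \<longlonglongrightarrow> 0"
proof -
  let ?G = "G\<lparr>pay := \<lambda>_ _. 1\<rparr>" and ?z = "\<lambda>k. stationary (z k)"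
  interpret prob_space "play G ?z s" by (rule prob_space_play)
  have "play_kernel ?G ?z s = play_kernel G ?z s"
    by (simp add: play_kernel_def fun_eq_iff split: nat.split)
  then have play: "play ?G ?z s = play G ?z s"
    by (simp add: play_def)
  have "expected_payoff ?G ?z One s = (\<integral>\<omega>. 1 \<partial>play G ?z s)"
    unfolding expected_payoff_def play
  proof (rule integral_cong_AE)
    show "payoff ?G One \<in> borel_measurable (play G ?z s)"
      using measurable_payoff[of ?G One ?z s] by (simp add: play)
    show "AE \<omega> in play G ?z s. payoff ?G One \<omega> = 1"
      using assms[unfolded surely_absorbed_def, rule_format, of s]
      by eventually_elim (simp add: payoff_def absorbed_def)
  qed simp
  then have "expected_payoff ?G ?z One s = 1"
    using prob_space by simp
  then have "(\<lambda>d. finite_payoff ?G d ?z One s) \<longlonglongrightarrow> 1"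
    using finite_payoff_tendsto[of ?G ?z One s] by simp
  from tendsto_diff[OF tendsto_const[of 1] this] show ?thesis
    unfolding survival_def by simp
qed

section \<open>Gains and their variance\<close>

locale balanced_stationary =
  fixes G :: "('s::finite, 'm::finite) game" and w :: real
    and c :: "player \<Rightarrow> 's \<Rightarrow> real" and z :: "player \<Rightarrow> ('s, 'm) stationary"
    and \<epsilon> \<delta> :: real
  assumes game: "absorbing_positive_recursive_game G w"
    and val: "\<And>i s. is_value G i s (c i s)"
    and stat: "\<And>k. is_stationary G k (z k)"
    and eps: "0 < \<epsilon>" "\<epsilon> < 1 / 2" and delta: "0 < \<delta>" "\<delta> \<le> \<epsilon> ^ 3 / real CARD('s)"
    and jump: "\<And>k s. r_stat G z k s > jump G c k (z (other k)) s - \<epsilon>"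
    and balanced: "\<And>k s m. m \<in> set_pmf (z k s) \<Longrightarrow> \<bar>w_stat G z k s m - r_stat G z k s\<bar> \<le> \<delta>"
begin

abbreviation r :: "player \<Rightarrow> 's \<Rightarrow> real" where
  "r \<equiv> r_stat G z"

abbreviation stage_law :: "'s \<Rightarrow> (('s, 'm) stage \<times> 's) pmf" where
  "stage_law s \<equiv> step_pmf G (\<lambda>k. z k s) s"

text \<open>
  What the move of Player \<open>k\<close> adds to the payoff he may expect, the opponent's move being
  averaged out. With \<open>s\<^sub>t\<close> the state at stage \<open>t\<close>, subtracting the
  accumulated gain from \<open>r k s\<^sub>t\<close> leaves a martingale up to absorption, however
  Player \<open>k\<close> plays, as long as the opponent follows \<open>z\<close>.
\<close>
definition gain :: "player \<Rightarrow> ('s, 'm) stage \<Rightarrow> real" where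
  "gain k x = w_stat G z k (fst x) (move k x) - r k (fst x)"

definition total_gain :: "player \<Rightarrow> ('s, 'm) stage list \<Rightarrow> real" where
  "total_gain k h = sum_list (map (gain k) h)"

lemma total_gain_Nil [simp]: "total_gain k [] = 0"
  by (simp add: total_gain_def)

lemma total_gain_snoc [simp]: "total_gain k (h @ [x]) = total_gain k h + gain k x"
  by (simp add: total_gain_def)

definition legal :: "('s, 'm) stage list \<Rightarrow> bool" where
  "legal h \<longleftrightarrow> (\<forall>x\<in>set h. \<forall>k. move k x \<in> set_pmf (z k (fst x)))"

lemma r_absorbing: "s \<in> absorbing G \<Longrightarrow> r k s = pay G k s"
  unfolding r_stat_def by (subst expected_payoff_step) simp

lemma r_harmonic:
  "s \<notin> absorbing G \<Longrightarrow> r k s = measure_pmf.expectation (stage_law s) (\<lambda>y. r k (snd y))"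
  unfolding r_stat_def by (subst expected_payoff_step) (simp add: stationary_def continuation_def case_prod_beta')

lemma r_bounds: "least_payoff k \<le> r k s" "r k s \<le> least_payoff k + 1"
  unfolding r_stat_def using expected_payoff_bounds[OF game] by auto

lemma c_less: "c k s < r k s + \<epsilon>"
proof -
  have "c k s \<le> jump G c k (z (other k)) s"
    using val stat game
    by (intro value_le_jump) (auto simp: absorbing_positive_recursive_game_def)
  with jump[of k s] show ?thesis by simp
qed

lemma w_stat_eq:
  assumes "\<alpha> (other k) = z (other k) s"
  shows "w_stat G z k s m
    = measure_pmf.expectation (step_pmf G (\<alpha>(k := return_pmf m)) s) (\<lambda>y. r k (snd y))"
  unfolding w_stat_def by (rule expected_next_eq) (rule assms)

lemma expectation_w_stat:
  assumes "s \<notin> absorbing G"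
  shows "measure_pmf.expectation (z k s) (w_stat G z k s) = r k s"
proof -
  have "w_stat G z k s = (\<lambda>m. measure_pmf.expectation
      (step_pmf G ((\<lambda>k. z k s)(k := return_pmf m)) s) (\<lambda>y. r k (snd y)))"
    by (rule ext, rule w_stat_eq) (rule refl)
  then show ?thesis
    using r_harmonic[OF assms, of k] by (simp only: expectation_step_split[of G "\<lambda>k. z k s" s _ k])
qed

text \<open>
  A sum of convex functions of \<open>r k s\<close>, one with its kink at each value of \<open>r
  k\<close>. It serves to bound the total variation of \<open>r k\<close> along a play by the number of
  states.
\<close>
definition spread :: "player \<Rightarrow> 's \<Rightarrow> real" where
  "spread k s = (\<Sum>u\<in>UNIV. \<bar>r k s - r k u\<bar>)"

lemma spread_le: "spread k s \<le> real CARD('s)"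
proof -
  have "spread k s \<le> (\<Sum>u\<in>(UNIV :: 's set). 1)"
    unfolding spread_def using r_bounds[of k] by (intro sum_mono) (smt (verit))
  then show ?thesis by simp
qed

text \<open>
  As \<open>r k\<close> is harmonic, Jensen's inequality makes every term of \<open>spread\<close> a
  submartingale. The term with \<open>u = s\<close> vanishes before the stage and is the size of the
  change of \<open>r k\<close> after it, so the drift of the sum dominates the expected change.
\<close>

lemma spread_increases:
  assumes "s \<notin> absorbing G"
  shows "measure_pmf.expectation (stage_law s) (\<lambda>y. \<bar>r k (snd y) - r k s\<bar>)
    \<le> measure_pmf.expectation (stage_law s) (\<lambda>y. spread k (snd y)) - spread k s"
proof -
  let ?E = "measure_pmf.expectation (stage_law s)"
  have jensen: "\<bar>r k s - r k u\<bar> \<le> ?E (\<lambda>y. \<bar>r k (snd y) - r k u\<bar>)" for u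
  proof -
    have "r k s - r k u = ?E (\<lambda>y. r k (snd y) - r k u)"
      by (subst Bochner_Integration.integral_diff)
         (auto intro: integrable_measure_pmf_finite simp: r_harmonic[OF assms, symmetric])
    then show ?thesis by (metis integral_abs_bound)
  qed
  have "?E (\<lambda>y. spread k (snd y)) - spread k s
      = (\<Sum>u\<in>UNIV. ?E (\<lambda>y. \<bar>r k (snd y) - r k u\<bar>) - \<bar>r k s - r k u\<bar>)"
    unfolding spread_def sum_subtractf
    by (subst Bochner_Integration.integral_sum) (auto intro: integrable_measure_pmf_finite)
  also have "\<dots> \<ge> ?E (\<lambda>y. \<bar>r k (snd y) - r k s\<bar>) - \<bar>r k s - r k s\<bar>"
    using jensen by (intro member_le_sum) auto
  finally show ?thesis by simp
qed

text \<open>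
  The expected variance still to come is at most \<open>\<delta>\<close> times the expected remaining
  variation of \<open>r k\<close>, for which \<open>CARD('s) - spread k s\<close> is a bound.
\<close>
definition potential :: "player \<Rightarrow> ('s, 'm) stage list \<Rightarrow> 's \<Rightarrow> real" where
  "potential k h s = (total_gain k h)\<^sup>2 + \<delta> * (real CARD('s) - spread k s)"

lemma potential_ge: "(total_gain k h)\<^sup>2 \<le> potential k h s"
  using spread_le[of k s] delta by (simp add: potential_def)

text \<open>
  Under \<open>z\<close> the gain \<open>g\<close> of a stage has mean \<open>0\<close>, so the square
  of the total gain grows on average by the mean of \<open>g\<^sup>2\<close>. By balance
  \<open>g\<^sup>2 \<le> \<delta> * \<bar>g\<bar>\<close>, and \<open>\<bar>g\<bar>\<close> is at most
  the expected change of \<open>r k\<close> given the move of Player \<open>k\<close>. The growth is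
  therefore paid for by the increase of \<open>spread\<close>.
\<close>

lemma potential_supermartingale:
  assumes s: "s \<notin> absorbing G"
  shows "measure_pmf.expectation (stage_law s) (\<lambda>y. potential k (h @ [fst y]) (snd y)) \<le> potential k h s"
proof -
  let ?E = "measure_pmf.expectation (stage_law s)"
  let ?g = "\<lambda>m. w_stat G z k s m - r k s"
  let ?M = "total_gain k h" and ?n = "real CARD('s)"
  have int: "integrable (measure_pmf (stage_law s)) f" for f :: "_ \<Rightarrow> real"
    by (intro integrable_measure_pmf_finite) simp
  have int': "integrable (measure_pmf (z k s)) f" for f :: "_ \<Rightarrow> real"
    by (intro integrable_measure_pmf_finite) simp
  have mean: "?E (\<lambda>y. ?g (move k (fst y))) = 0"
    by (subst expectation_step_move[where f="?g"])
       (simp add: Bochner_Integration.integral_diff int' expectation_w_stat[OF s])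
  have "?E (\<lambda>y. (?g (move k (fst y)))\<^sup>2) = measure_pmf.expectation (z k s) (\<lambda>m. (?g m)\<^sup>2)"
    by (rule expectation_step_move[where f="\<lambda>m. (?g m)\<^sup>2"])
  also have "\<dots> \<le> measure_pmf.expectation (z k s) (\<lambda>m. \<delta> * measure_pmf.expectation
        (step_pmf G ((\<lambda>k. z k s)(k := return_pmf m)) s) (\<lambda>y. \<bar>r k (snd y) - r k s\<bar>))"
  proof (rule expectation_mono_pmf)
    fix m assume m: "m \<in> set_pmf (z k s)"
    let ?E' = "measure_pmf.expectation (step_pmf G ((\<lambda>k. z k s)(k := return_pmf m)) s)"
    have "?g m = ?E' (\<lambda>y. r k (snd y) - r k s)"
      by (subst Bochner_Integration.integral_diff)
         (auto intro: integrable_measure_pmf_finite simp: w_stat_eq[of "\<lambda>k. z k s"])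
    then have "\<bar>?g m\<bar> \<le> ?E' (\<lambda>y. \<bar>r k (snd y) - r k s\<bar>)"
      by (metis integral_abs_bound)
    then have "\<bar>?g m\<bar> * \<bar>?g m\<bar> \<le> \<delta> * ?E' (\<lambda>y. \<bar>r k (snd y) - r k s\<bar>)"
      using balanced[OF m] delta by (intro mult_mono) auto
    then show "(?g m)\<^sup>2 \<le> \<delta> * ?E' (\<lambda>y. \<bar>r k (snd y) - r k s\<bar>)"
      by (simp add: power2_eq_square abs_mult_self_eq)
  qed
  also have "\<dots> = \<delta> * ?E (\<lambda>y. \<bar>r k (snd y) - r k s\<bar>)"
    by (simp add: expectation_step_split[of G "\<lambda>k. z k s" s _ k])
  also have "\<dots> \<le> \<delta> * (?E (\<lambda>y. spread k (snd y)) - spread k s)"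
    using spread_increases[OF s, of k] delta by (intro mult_left_mono) auto
  finally have var: "?E (\<lambda>y. (?g (move k (fst y)))\<^sup>2) \<le> \<delta> * (?E (\<lambda>y. spread k (snd y)) - spread k s)" .
  have "?E (\<lambda>y. potential k (h @ [fst y]) (snd y))
     = ?E (\<lambda>y. ?M\<^sup>2 + 2 * ?M * ?g (move k (fst y)) + (?g (move k (fst y)))\<^sup>2 + \<delta> * ?n - \<delta> * spread k (snd y))"
    by (intro integral_cong_AE)
       (auto simp: AE_measure_pmf_iff potential_def gain_def power2_eq_square algebra_simps dest!: fst_step_pmf)
  also have "\<dots> = ?M\<^sup>2 + 2 * ?M * ?E (\<lambda>y. ?g (move k (fst y))) + ?E (\<lambda>y. (?g (move k (fst y)))\<^sup>2)
      + \<delta> * ?n - \<delta> * ?E (\<lambda>y. spread k (snd y))"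
    by (simp only: Bochner_Integration.integral_add[OF int int] Bochner_Integration.integral_diff[OF int int]
        integral_mult_right_zero lebesgue_integral_const measure_pmf.prob_space scaleR_one)
  also have "\<dots> \<le> potential k h s"
    using mean var by (simp add: potential_def algebra_simps)
  finally show ?thesis .
qed

end

section \<open>Monitoring and punishing\<close>

locale threat_strategies = balanced_stationary G w c z \<epsilon> \<delta>
  for G :: "('s::finite, 'm::finite) game" and w c z \<epsilon> \<delta> +
  fixes \<eta> :: real and N :: nat and \<rho> :: "player \<Rightarrow> ('s, 'm) strategy"
  assumes eta: "0 < \<eta>"
    and threat: "\<And>k. punishes G (other k) \<eta> (c (other k)) (\<rho> k)"
begin

text \<open>
  The three clauses answer the three ways to profit from a deviation: to prevent absorption forever
  (worthwhile for Player One when \<open>r One\<close> is negative), to use a move that \<open>z\<close>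
  does not use, and to choose among the moves of \<open>z\<close> with wrong frequencies. Only gains are
  tested, as a player does not profit from losses.
\<close>
definition stop :: "('s, 'm) stage list \<Rightarrow> 's \<Rightarrow> bool" where
  "stop h s \<longleftrightarrow> N \<le> length h \<or> \<not> legal h \<or> (\<exists>k. 2 * \<epsilon> < total_gain k h)"

definition profile :: "player \<Rightarrow> ('s, 'm) strategy" where
  "profile k = switch stop (z k) (\<rho> k)"

lemma is_strategy_profile: "is_strategy G k (profile k)"
  using threat[of k] stat[of k] by (cases k) (auto simp: profile_def punishes_def intro!: is_strategy_switch)

lemma profile_before:
  "\<not> stopped_before stop h \<Longrightarrow> \<not> stop h s \<Longrightarrow> profile k h s = z k s"
  by (simp add: profile_def switch_before)

lemma stopped_payoff:
  assumes "\<not> stopped_before stop h" "stop h s" "is_strategy G i \<tau>"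
  shows "expected_payoff G ((\<lambda>k. continuation h (profile k))(i := \<tau>)) i s \<le> c i s + \<eta>"
proof -
  have oo: "other (other i) = i" by (cases i) auto
  have "((\<lambda>k. continuation h (profile k))(i := \<tau>)) (other i) h' t = \<rho> (other i) h' t"
    if "initial_state h' t = s" for h' t
    using switch_after[OF assms(1,2) that] by (simp add: continuation_def profile_def)
  then show ?thesis
    using threat[of "other i", unfolded oo punishes_def] assms(3) by simp
qed

text \<open>
  The right-hand side is a martingale while the moves of Player \<open>k\<close> are legal, by the
  choice of \<open>gain\<close>. At a stop he is held to \<open>c k s + \<eta> < r k s + \<epsilon> +
  \<eta>\<close>, also when the stop is caused by the test of the opponent, which he might provoke. An
  illegal move leads to punishment at the next state, worth at most \<open>jump + \<eta>\<close> on
  average. The total gain is at most \<open>2 * \<epsilon>\<close> before the stop, hence at most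
  \<open>2 * \<epsilon> + \<delta>\<close> at the stop.
\<close>

lemma deviation_payoff_le:
  assumes "is_strategy G k \<tau>" "\<not> stopped_before stop h" "legal h" "total_gain k h \<le> 2 * \<epsilon> + \<delta>"
  shows "expected_payoff G ((\<lambda>j. continuation h (profile j))(k := continuation h \<tau>)) k s
    \<le> r k s + (3 * \<epsilon> + \<delta> + \<eta>) - total_gain k h"
  using assms(2-)
proof (induction "N - length h" arbitrary: h s rule: less_induct)
  case less
  let ?K = "3 * \<epsilon> + \<delta> + \<eta>"
  let ?\<sigma> = "\<lambda>h. (\<lambda>j. continuation h (profile j))(k := continuation h \<tau>)"
  consider "stop h s" | "\<not> stop h s" "s \<in> absorbing G" | "\<not> stop h s" "s \<notin> absorbing G" by blast
  then show ?case
  proof cases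
    case 1
    then have "expected_payoff G (?\<sigma> h) k s \<le> c k s + \<eta>"
      using less.prems by (intro stopped_payoff is_strategy_continuation assms(1))
    then show ?thesis using c_less[of k s] less.prems(3) by linarith
  next
    case 2
    then have "expected_payoff G (?\<sigma> h) k s = r k s"
      by (simp add: expected_payoff_step r_absorbing)
    with less.prems(3) eps eta show ?thesis by linarith
  next
    case 3
    then have len: "length h < N" and gain: "total_gain k h \<le> 2 * \<epsilon>"
      by (auto simp: stop_def not_less)
    define \<alpha> where "\<alpha> = (\<lambda>j. ?\<sigma> h j [] s)"
    have \<alpha>_other: "\<alpha> (other k) = z (other k) s"
      using profile_before[OF less.prems(1) 3(1)] by (simp add: \<alpha>_def continuation_def)
    have \<alpha>_k: "\<alpha> k = \<tau> h s"
      by (simp add: \<alpha>_def continuation_def)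
    have cont: "(\<lambda>j. continuation [x] (?\<sigma> h j)) = ?\<sigma> (h @ [x])" for x
      by (auto simp: fun_eq_iff continuation_append)
    let ?V = "\<lambda>y. expected_payoff G (?\<sigma> (h @ [fst y])) k (snd y)"
    let ?E = "\<lambda>m. measure_pmf.expectation (step_pmf G (\<alpha>(k := return_pmf m)) s)"
    have int: "integrable (measure_pmf (step_pmf G (\<alpha>(k := return_pmf m)) s)) f" for m and f :: "_ \<Rightarrow> real"
      by (intro integrable_measure_pmf_finite) simp
    have snoc: "\<not> stopped_before stop (h @ [x])" if "fst x = s" for x
      using less.prems(1) 3(1) that by (simp add: stopped_before_snoc)
    have main: "?E m ?V \<le> r k s + ?K - total_gain k h" if m: "m \<in> set_pmf (\<alpha> k)" for m
    proof (cases "m \<in> set_pmf (z k s)")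
      case True
      let ?g = "w_stat G z k s m - r k s"
      have "?E m ?V \<le> ?E m (\<lambda>y. r k (snd y) + (?K - total_gain k h - ?g))"
      proof (rule expectation_mono_pmf)
        fix y assume y: "y \<in> set_pmf (step_pmf G (\<alpha>(k := return_pmf m)) s)"
        have x: "fst (fst y) = s" "move k (fst y) = m" "move (other k) (fst y) \<in> set_pmf (z (other k) s)"
          using fst_step_pmf[OF y] move_step_pmf[OF y, of k] move_step_pmf[OF y, of "other k"]
            \<alpha>_other by auto
        have "move j (fst y) \<in> set_pmf (z j s)" for j
          using x(2,3) True eq_or_other[of j k] by auto
        then have "legal (h @ [fst y])"
          using less.prems(2) x(1) by (auto simp: legal_def)
        moreover have g: "gain k (fst y) = ?g"
          using x by (simp add: gain_def)
        moreover have "total_gain k (h @ [fst y]) \<le> 2 * \<epsilon> + \<delta>"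
          using g gain balanced[OF True] by simp
        ultimately have "?V y \<le> r k (snd y) + ?K - total_gain k (h @ [fst y])"
          using len snoc[OF x(1)] by (intro less.hyps) auto
        then show "?V y \<le> r k (snd y) + (?K - total_gain k h - ?g)"
          using g by simp
      qed
      also have "\<dots> = w_stat G z k s m + (?K - total_gain k h - ?g)"
        by (simp add: Bochner_Integration.integral_add[OF int int] w_stat_eq[of \<alpha>, OF \<alpha>_other])
      finally show ?thesis by simp
    next
      case False
      have "?E m ?V \<le> ?E m (\<lambda>y. c k (snd y) + \<eta>)"
      proof (rule expectation_mono_pmf)
        fix y assume y: "y \<in> set_pmf (step_pmf G (\<alpha>(k := return_pmf m)) s)"
        have x: "fst (fst y) = s" "move k (fst y) = m"
          using fst_step_pmf[OF y] move_step_pmf[OF y, of k] by auto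
        then have "\<not> legal (h @ [fst y])"
          using False by (auto simp: legal_def)
        then show "?V y \<le> c k (snd y) + \<eta>"
          using snoc[OF x(1)] by (intro stopped_payoff is_strategy_continuation assms(1)) (simp_all add: stop_def)
      qed
      also have "\<dots> = expected_next G k (z (other k)) (c k) s m + \<eta>"
        by (simp add: Bochner_Integration.integral_add[OF int int] expected_next_eq[of \<alpha> k "z (other k)" s, OF \<alpha>_other])
      also have "\<dots> \<le> jump G c k (z (other k)) s + \<eta>"
        using assms(1) m by (auto simp: \<alpha>_k is_strategy_def intro!: expected_next_le_jump)
      finally show ?thesis using jump[of k s] gain delta by linarith
    qed
    have "expected_payoff G (?\<sigma> h) k s = measure_pmf.expectation (step_pmf G \<alpha> s) ?V"
      using 3(2) by (subst expected_payoff_step) (simp only: if_False cont \<alpha>_def case_prod_beta')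
    also have "\<dots> = measure_pmf.expectation (\<alpha> k) (\<lambda>m. ?E m ?V)"
      by (rule expectation_step_split)
    also have "\<dots> \<le> measure_pmf.expectation (\<alpha> k) (\<lambda>m. r k s + ?K - total_gain k h)"
      by (rule expectation_mono_pmf) (rule main)
    finally show ?thesis by simp
  qed
qed

text \<open>
  A bound for the probability that the play will be stopped before absorption if both players follow
  \<open>z\<close> and \<open>d\<close> stages remain: by a Chebyshev estimate for the two tests, and by
  the probability of survival for the deadline
\<close>
definition loss :: "nat \<Rightarrow> ('s, 'm) stage list \<Rightarrow> 's \<Rightarrow> real" where
  "loss d h s = (potential One h s + potential Two h s) / (2 * \<epsilon>)\<^sup>2 + survival G z d s"

lemma loss_nonneg: "0 \<le> loss d h s"
proof -
  have "0 \<le> potential k h s" for k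
    using potential_ge[of k h s] by (rule order_trans[rotated]) simp
  then show ?thesis
    unfolding loss_def by (intro add_nonneg_nonneg divide_nonneg_nonneg survival_nonneg) auto
qed

lemma loss_ge_1:
  assumes "stop h s" "legal h"
  shows "1 \<le> loss (N - length h) h s"
proof -
  have pos: "0 \<le> potential k h s" for k
    using potential_ge[of k h s] by (rule order_trans[rotated]) simp
  have big: "1 \<le> loss d h s" if k: "2 * \<epsilon> < total_gain k h" for k d
  proof -
    \<comment> \<open>The test of one player suffices, because the potential of the other is nonnegative.\<close>
    have "(2 * \<epsilon>)\<^sup>2 \<le> (total_gain k h)\<^sup>2"
      using k eps by (intro power_mono) auto
    also have "\<dots> \<le> potential One h s + potential Two h s"
      using potential_ge[of k h s] pos[of "other k"] by (cases k) auto
    finally have "1 \<le> (potential One h s + potential Two h s) / (2 * \<epsilon>)\<^sup>2"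
      using eps by (simp add: le_divide_eq)
    then show ?thesis
      using survival_nonneg[of G z d s] unfolding loss_def by linarith
  qed
  have late: "1 \<le> loss (N - length h) h s" if "N \<le> length h"
    unfolding loss_def using that pos[of One] pos[of Two] by simp
  from assms big late show ?thesis unfolding stop_def by blast
qed

lemma loss_supermartingale:
  assumes s: "s \<notin> absorbing G"
  shows "measure_pmf.expectation (stage_law s) (\<lambda>y. loss d (h @ [fst y]) (snd y)) \<le> loss (Suc d) h s"
proof -
  have int: "integrable (measure_pmf (stage_law s)) f" for f :: "_ \<Rightarrow> real"
    by (intro integrable_measure_pmf_finite) simp
  let ?E = "measure_pmf.expectation (stage_law s)"
  have "?E (\<lambda>y. loss d (h @ [fst y]) (snd y))
      = (?E (\<lambda>y. potential One (h @ [fst y]) (snd y)) + ?E (\<lambda>y. potential Two (h @ [fst y]) (snd y)))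
        / (2 * \<epsilon>)\<^sup>2 + ?E (\<lambda>y. survival G z d (snd y))"
    unfolding loss_def
    by (simp only: Bochner_Integration.integral_add[OF int int] integral_divide_zero)
  also have "\<dots> \<le> loss (Suc d) h s"
    unfolding loss_def survival_Suc[OF s]
    by (intro add_mono divide_right_mono potential_supermartingale s order_refl) auto
  finally show ?thesis .
qed

text \<open>
  All payoffs of a player lie in an interval of length \<open>1\<close>, so that a stop costs him at
  most \<open>1\<close>, and \<open>loss\<close> is a nonnegative supermartingale that is at least
  \<open>1\<close> at a stop before absorption.
\<close>

lemma profile_payoff_ge:
  assumes "\<not> stopped_before stop h" "legal h"
  shows "r k s - loss (N - length h) h s \<le> expected_payoff G (\<lambda>j. continuation h (profile j)) k s"
  using assms
proof (induction "N - length h" arbitrary: h s rule: less_induct)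
  case less
  let ?\<sigma> = "\<lambda>h j. continuation h (profile j)"
  consider "s \<in> absorbing G" | "stop h s" | "\<not> stop h s" "s \<notin> absorbing G" by blast
  then show ?case
  proof cases
    case 1
    then have "expected_payoff G (?\<sigma> h) k s = r k s"
      by (simp add: expected_payoff_step r_absorbing)
    then show ?thesis using loss_nonneg by simp
  next
    case 2
    have "r k s - 1 \<le> expected_payoff G (?\<sigma> h) k s"
      using r_bounds(2)[of k s] expected_payoff_bounds(1)[OF game, of k "?\<sigma> h" s] by simp
    then show ?thesis using loss_ge_1[OF 2 less.prems(2)] by simp
  next
    case 3
    then have len: "length h < N"
      by (auto simp: stop_def not_less)
    define d where "d = N - Suc (length h)"
    have d: "N - length h = Suc d" using len by (simp add: d_def)
    have first: "(\<lambda>j. ?\<sigma> h j [] s) = (\<lambda>j. z j s)"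
      using profile_before[OF less.prems(1) 3(1)] by (simp add: continuation_def)
    have cont: "(\<lambda>j. continuation [x] (?\<sigma> h j)) = ?\<sigma> (h @ [x])" for x
      by (auto simp: fun_eq_iff continuation_append)
    let ?E = "measure_pmf.expectation (stage_law s)"
    have int: "integrable (measure_pmf (stage_law s)) f" for f :: "_ \<Rightarrow> real"
      by (intro integrable_measure_pmf_finite) simp
    have "r k s - loss (N - length h) h s
        \<le> ?E (\<lambda>y. r k (snd y)) - ?E (\<lambda>y. loss d (h @ [fst y]) (snd y))"
      using r_harmonic[OF 3(2)] loss_supermartingale[OF 3(2)] by (simp add: d)
    also have "\<dots> = ?E (\<lambda>y. r k (snd y) - loss d (h @ [fst y]) (snd y))"
      by (simp only: Bochner_Integration.integral_diff[OF int int])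
    also have "\<dots> \<le> ?E (\<lambda>y. expected_payoff G (?\<sigma> (h @ [fst y])) k (snd y))"
    proof (rule expectation_mono_pmf)
      fix y assume y: "y \<in> set_pmf (stage_law s)"
      have x: "fst (fst y) = s" "move j (fst y) \<in> set_pmf (z j s)" for j
        using fst_step_pmf[OF y] move_step_pmf[OF y, of j] by auto
      have "legal (h @ [fst y])" "\<not> stopped_before stop (h @ [fst y])"
        using less.prems 3(1) x by (auto simp: legal_def stopped_before_snoc)
      then show "r k (snd y) - loss d (h @ [fst y]) (snd y) \<le> expected_payoff G (?\<sigma> (h @ [fst y])) k (snd y)"
        using less.hyps[of "h @ [fst y]" "snd y"] len by (simp add: d_def)
    qed
    also have "\<dots> = expected_payoff G (?\<sigma> h) k s"
      using 3(2) expected_payoff_step[of G "?\<sigma> h" k s]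
      by (simp only: if_False first cont case_prod_beta')
    finally show ?thesis .
  qed
qed

text \<open>
  The initial loss is at most \<open>2 * \<epsilon>^3 / (2 * \<epsilon>)\<^sup>2 + \<epsilon> / 8 = 5 /
  8 * \<epsilon>\<close>, and a deviation yields at most \<open>3 * \<epsilon> + \<delta> +
  \<eta>\<close> above \<open>r\<close>, where \<open>\<delta> \<le> \<epsilon> / 4\<close> and
  \<open>\<eta> \<le> \<epsilon> / 8\<close>; these add up to \<open>4 * \<epsilon>\<close>.
\<close>

lemma profile_is_equilibrium:
  assumes eta_le: "\<eta> \<le> \<epsilon> / 8" and surv: "\<And>s. survival G z N s \<le> \<epsilon> / 8"
  shows "is_equilibrium G (4 * \<epsilon>) profile"
  unfolding is_equilibrium_def
proof (intro conjI allI impI is_strategy_profile)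
  fix s k \<tau> assume \<tau>: "is_strategy G k \<tau>"
  have init: "\<not> stopped_before stop []" "legal []"
    by (simp_all add: stopped_before_def legal_def)
  have n: "real CARD('s) \<ge> 1"
    using zero_less_card_finite[where 'a='s] by linarith
  have dn: "\<delta> * real CARD('s) \<le> \<epsilon> ^ 3"
    using delta n by (simp add: field_simps)
  have "\<delta> \<le> \<delta> * real CARD('s)"
    using mult_left_mono[OF n, of \<delta>] delta by simp
  also note dn
  also have "\<epsilon> ^ 3 \<le> \<epsilon> / 4"
  proof -
    have "\<epsilon> * \<epsilon> \<le> (1 / 2) * (1 / 2)" using eps by (intro mult_mono) auto
    from mult_left_mono[OF this, of \<epsilon>] eps show ?thesis by (simp add: power3_eq_cube)
  qed
  finally have d: "\<delta> \<le> \<epsilon> / 4" .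
  have "potential j [] s \<le> \<epsilon> ^ 3" for j
  proof -
    have "0 \<le> spread j s" by (simp add: spread_def sum_nonneg)
    then have "\<delta> * (real CARD('s) - spread j s) \<le> \<delta> * real CARD('s)"
      using delta by (intro mult_left_mono) auto
    with dn show ?thesis by (simp add: potential_def)
  qed
  then have "loss N [] s \<le> (\<epsilon> ^ 3 + \<epsilon> ^ 3) / (2 * \<epsilon>)\<^sup>2 + \<epsilon> / 8"
    unfolding loss_def by (intro add_mono divide_right_mono surv) auto
  also have "(\<epsilon> ^ 3 + \<epsilon> ^ 3) / (2 * \<epsilon>)\<^sup>2 = \<epsilon> / 2"
    using eps by (simp add: power2_eq_square power3_eq_cube field_simps)
  finally have L: "loss N [] s \<le> 5 / 8 * \<epsilon>" by simp
  have "r k s - loss N [] s \<le> expected_payoff G profile k s"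
    using profile_payoff_ge[OF init, of k s] by simp
  moreover have "expected_payoff G (profile(k := \<tau>)) k s \<le> r k s + (3 * \<epsilon> + \<delta> + \<eta>)"
    using deviation_payoff_le[OF \<tau> init, of s] eps delta by simp
  ultimately show "expected_payoff G (profile(k := \<tau>)) k s \<le> expected_payoff G profile k s + 4 * \<epsilon>"
    using L d eta_le by linarith
qed

end

theorem corollary4p3:
  fixes G :: "('s::finite, 'm::finite) game"
    and c :: "player \<Rightarrow> 's \<Rightarrow> real"
    and x y :: "('s, 'm) stationary"
    and z :: "player \<Rightarrow> ('s, 'm) stationary"
    and n :: nat and \<omega> \<epsilon> \<delta> :: real
  assumes "absorbing_positive_recursive_game G \<omega>"
    and "n = CARD('s)"
    and "\<And>i s. is_value G i s (c i s)"
    and "is_stationary G One x" and "is_stationary G Two y"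
    and "z = case_player x y"
    and "surely_absorbed G (\<lambda>k. stationary (z k))"
    and "0 < \<epsilon>" and "\<epsilon> < 1/2" and "0 < \<delta>"
    and "\<And>k s. r_stat G z k s > jump G c k (z (other k)) s - \<epsilon>"
    and "\<And>k s m. m \<in> set_pmf (z k s) \<Longrightarrow> \<bar>w_stat G z k s m - r_stat G z k s\<bar> \<le> \<delta>"
    and "\<delta> \<le> \<epsilon>^3 / real n"
  shows "generates_equilibrium G c \<epsilon> z"
proof -
  have stat: "is_stationary G k (z k)" for k
    using assms(4-6) by (cases k) auto
  interpret balanced_stationary G \<omega> c z \<epsilon> \<delta>
    using assms stat by unfold_locales auto
  have "\<forall>k. \<exists>\<rho>. punishes G (other k) (\<epsilon> / 8) (c (other k)) \<rho>"
    using punishing_strategy_exists[of G _ "c _" "\<epsilon> / 8"] assms(3) \<open>0 < \<epsilon>\<close> by simp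
  then obtain \<rho> where \<rho>: "\<And>k. punishes G (other k) (\<epsilon> / 8) (c (other k)) (\<rho> k)"
    by metis
  have "\<forall>\<^sub>F d in sequentially. survival G z d s < \<epsilon> / 8" for s
    using survival_tendsto_0[OF assms(7)] \<open>0 < \<epsilon>\<close> by (intro order_tendstoD) auto
  then have "\<forall>\<^sub>F d in sequentially. \<forall>s. survival G z d s < \<epsilon> / 8"
    by (rule eventually_all_finite)
  then obtain N where N: "\<And>s. survival G z N s < \<epsilon> / 8"
    by (auto simp: eventually_sequentially)
  interpret threat_strategies G \<omega> c z \<epsilon> \<delta> "\<epsilon> / 8" N \<rho>
    using \<open>0 < \<epsilon>\<close> \<rho> by unfold_locales auto
  show ?thesis
    unfolding generates_equilibrium_def
  proof (intro exI conjI allI impI)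
    show "is_equilibrium G (4 * \<epsilon>) profile"
      using N by (intro profile_is_equilibrium) (auto intro: less_imp_le)
    show "0 < \<epsilon> / 8" "\<epsilon> / 8 \<le> \<epsilon>" using \<open>0 < \<epsilon>\<close> by auto
    show "profile k h s = z k s" if "\<not> stopped_before stop h \<and> \<not> stop h s" for k h s
      using that by (simp add: profile_before)
    show "expected_payoff G ((\<lambda>k. continuation h (profile k))(i := \<tau>)) i s \<le> c i s + \<epsilon> / 8"
      if "\<not> stopped_before stop h \<and> stop h s" "is_strategy G i \<tau>" for h s i \<tau>
      using that by (intro stopped_payoff) auto
  qed
qed

end
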